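(* Let $p\in\{1,2\}$ and $k\in\{1,2\}$. Assume that the solution $\mathbf{u}$ of the harmonic map heat flow problem $$\partial_t\mathbf{u}=\Delta\mathbf{u}+|\nabla\mathbf{u}|^2\mathbf{u}\ \text{ on } D,\ t\in(0,T],\qquad \mathbf{u}(0,\cdot)=\mathbf{u}_0 \text{ on } D,\qquad \mathbf{u}(t,\cdot)=\mathbf{u}_0 \text{ on }\partial D,\ t\in[0,T],$$ with $\mathbf{u}_0\in C^2(\bar D,S^2)$ and $\mathbf{u}(t,\cdot):D\to S^2$, is sufficiently smooth. Let $(\mathbf{u}_h^j)_{0\le j\le J}$ (with $J\tau=T$) be the discrete approximation produced by the tangent space BDF$k$ finite element scheme described in the context, with time step $\tau$ and mesh size $h$. Assume that $\mathbf{u}_h^j$ converges uniformly to $\mathbf{u}(t_j,\cdot)$, $t_j=j\tau$, in the following sense: for arbitrary $\varepsilon\in(0,1]$ there exist $\varepsilon_1>0$, $\varepsilon_2>0$ (depending on $\mathbf{u}$) such that $$\delta_{\tau,h}:=\max_{0\le j\le J}\|\mathbf{u}_h^j-\mathbf{u}(t_j,\cdot)\|_{L^\infty}\le\varepsilon\quad\text{for all } \tau\le\varepsilon_1,\ h\le\varepsilon_2 .$$ Then there exists $\beta=\beta(\mathbf{u})>0$, independent of $h$ and $\tau$, such that for all sufficiently small $\tau$ and $h$ $$\sup_{\mathbf{v}_h\in\mathbf{V}_{h,0}^p\setminus\{0\}}\frac{\mathbf{b}(\hat{\mathbf{u}}_h^{j+1,(k)};\mathbf{v}_h,w_h)}{\|\mathbf{v}_h\|_{L^2}}\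 \ge\ \beta\,\|w_h\|_{L^2}\qquad\text{for all } w_h\in V_{h,0}^p \text{ and all } k-1\le j\le J-1 .$$
   Context: Domain and spaces. $D=\{x\in\mathbb{R}^2:|x|<1\}$ is the open unit disk, $S^2$ the unit sphere in $\mathbb{R}^3$, and $T>0$ is fixed. $(\cdot,\cdot)$ denotes the $L^2$ inner product on $D$ (for scalar, vector-valued and matrix-valued functions). $\mathcal{T}_h$ belongs to a family of regular (shape-regular) and quasi-uniform triangulations of $D$ with maximum mesh parameter $h$; the vertices of boundary triangles lie on $\partial D$. The finite element spaces are $$V_h^p=\{v\in C(D): v|_K\in\mathcal{P}_p\ \ \forall K\in\mathcal{T}_h\},\qquad \mathbf{V}_h^p=[V_h^p]^3,$$ where $\mathcal{P}_p$ denotes polynomials of degree at most $p$; for $p=2$ the isoparametric variants of these spaces are used. No notational distinction is made between $D$ and the domain covered by the triangulation. $V_{h,0}^p$ and $\mathbf{V}_{h,0}^p$ are the subspaces of functions that vanish on the boundary of the triangulation; $\mathbf{V}_{h,\mathbf{u}_0}^p$ is the set of functions in $\mathbf{V}_h^p$ taking the values of $\mathbf{u}_0$ at the boundary nodes. $\mathcal{I}_h$ is the nodal interpolation operator into $\mathbf{V}_h^p$. Bilinear form and discrete tangent space. For a vector field $\mathbf{u}$ on $D$, $\mathbf{v}_h\in\mathbf{V}_{h,0}^p$, $w_h\in V_{h,0}^p$, $$\mathbf{b}(\mathbf{u};\mathbf{v}_h,w_h):=(\mathbf{u}\cdot\mathbf{v}_h,w_h),\qquad \mathbf{T}_{h,0}^p(\mathbf{u}):=\{\mathbf{v}_h\in\mathbf{V}_{h,0}^p:\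 \mathbf{b}(\mathbf{u};\mathbf{v}_h,w_h)=0\ \ \forall w_h\in V_{h,0}^p\}.$$ BDF coefficients. $(\delta_0^{(1)},\delta_1^{(1)})=(1,-1)$ and $(\delta_0^{(2)},\delta_1^{(2)},\delta_2^{(2)})=(\tfrac32,-2,\tfrac12)$. Normalized extrapolations (defined pointwise on $D$): $$\hat{\mathbf{u}}_h^{j,(1)}=\frac{\mathbf{u}_h^{j-1}}{|\mathbf{u}_h^{j-1}|},\qquad \hat{\mathbf{u}}_h^{j,(2)}=\frac{2\mathbf{u}_h^{j-1}-\mathbf{u}_h^{j-2}}{|2\mathbf{u}_h^{j-1}-\mathbf{u}_h^{j-2}|}.$$ Scheme. Let $\tau>0$ and $J\in\mathbb{N}$ with $J\tau=T$. Set $\mathbf{u}_h^0=\mathcal{I}_h(\mathbf{u}_0)$; if $k=2$, $\mathbf{u}_h^1\in\mathbf{V}_{h,\mathbf{u}_0}^p$ is obtained by one step of the scheme with $k=1$. For $j=k-1,\dots,J-1$, find $\dot{\mathbf{u}}_h^{j+1}\in\mathbf{T}_{h,0}^p(\hat{\mathbf{u}}_h^{j+1,(k)})$ such that for all $\mathbf{v}_h\in\mathbf{T}_{h,0}^p(\hat{\mathbf{u}}_h^{j+1,(k)})$ $$(\dot{\mathbf{u}}_h^{j+1},\mathbf{v}_h)+\frac{\tau}{\delta_0^{(k)}}(\nabla\dot{\mathbf{u}}_h^{j+1},\nabla\mathbf{v}_h)=\sum_{i=1}^k\frac{\delta_i^{(k)}}{\delta_0^{(k)}}(\nabla\mathbf{u}_h^{j+1-i},\nabla\mathbf{v}_h),$$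 and set $$\mathbf{u}_h^{j+1}=\frac{\tau}{\delta_0^{(k)}}\dot{\mathbf{u}}_h^{j+1}-\sum_{i=1}^k\frac{\delta_i^{(k)}}{\delta_0^{(k)}}\mathbf{u}_h^{j+1-i}.$$ "Sufficiently smooth" means that $\mathbf{u}$ has as many bounded continuous derivatives in space and time on $[0,T]\times\bar D$ as required. *)

theory Defs
  imports "HOL-Analysis.Analysis" "HOL-Probability.Essential_Supremum"
begin

section \<open>Function spaces and the harmonic map heat flow\<close>

text \<open>\<open>C_on m S f\<close>: \<open>f\<close> is \<open>m\<close> times continuously differentiable on \<open>S\<close> up to the boundary.
  The partial derivatives \<open>g b\<close> are one-sided at boundary points of \<open>S\<close>; for the convex bodies
  \<open>S\<close> used here they are unique, and bounded because \<open>S\<close> is compact.\<close>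

primrec C_on :: "nat \<Rightarrow> 'a::euclidean_space set \<Rightarrow> ('a \<Rightarrow> 'b::real_normed_vector) \<Rightarrow> bool" where
  "C_on 0 S f \<longleftrightarrow> continuous_on S f"
| "C_on (Suc m) S f \<longleftrightarrow>
     (\<exists>g. (\<forall>x\<in>S. (f has_derivative (\<lambda>v. \<Sum>b\<in>Basis. (v \<bullet> b) *\<^sub>R g b x)) (at x within S)) \<and>
          (\<forall>b\<in>Basis. C_on m S (g b)))"

text \<open>The gradient of a vector field is its Jacobian matrix, so that \<open>\<bullet>\<close> and \<open>norm\<close> of gradients
  are the Frobenius inner product and norm. For finite element functions it is used as the
  elementwise gradient: it is unspecified only on the element interfaces, a null set.\<close>

abbreviation grad :: "(real^2 \<Rightarrow> real^3) \<Rightarrow> real^2 \<Rightarrow> real^2^3" where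
  "grad f x \<equiv> jacobian f (at x)"

definition laplacian :: "(real^2 \<Rightarrow> real^3) \<Rightarrow> real^2 \<Rightarrow> real^3" where
  "laplacian f x =
     (\<Sum>i\<in>UNIV. frechet_derivative (\<lambda>y. frechet_derivative f (at y) (axis i 1)) (at x) (axis i 1))"

definition hmhf_solution ::
  "real \<Rightarrow> (real^2 \<Rightarrow> real^3) \<Rightarrow> (real \<Rightarrow> real^2 \<Rightarrow> real^3) \<Rightarrow> bool" where
  "hmhf_solution T u0 u \<longleftrightarrow>
     (\<forall>t\<in>{0..T}. \<forall>x\<in>ball 0 1. u t x \<in> sphere 0 1) \<and>
     (\<forall>t\<in>{0<..T}. \<forall>x\<in>ball 0 1.
        ((\<lambda>s. u s x) has_vector_derivative
           (laplacian (u t) x + (norm (grad (u t) x))\<^sup>2 *\<^sub>R u t x)) (at t within {0..T})) \<and>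
     (\<forall>x\<in>ball 0 1. u 0 x = u0 x) \<and>
     (\<forall>t\<in>{0..T}. \<forall>x\<in>sphere 0 1. u t x = u0 x)"

definition l2_inner :: "(real^2) set \<Rightarrow> (real^2 \<Rightarrow> 'a::real_inner) \<Rightarrow> (real^2 \<Rightarrow> 'a) \<Rightarrow> real" where
  "l2_inner S f g = (LINT x:S|lebesgue. f x \<bullet> g x)"

definition l2_norm :: "(real^2) set \<Rightarrow> (real^2 \<Rightarrow> 'a::real_inner) \<Rightarrow> real" where
  "l2_norm S f = sqrt (l2_inner S f f)"

definition linf_norm :: "(real^2) set \<Rightarrow> (real^2 \<Rightarrow> 'a::real_normed_vector) \<Rightarrow> ereal" where
  "linf_norm S f = esssup (lebesgue_on S) (\<lambda>x. ereal (norm (f x)))"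


section \<open>Triangulations of the unit disk\<close>

definition vertices :: "(real^2) set \<Rightarrow> (real^2) set" where
  "vertices K = {a. a extreme_point_of K}"

text \<open>Lagrange nodes of degree \<open>p \<in> {1,2}\<close> of a straight triangle; \<open>midpoint a a = a\<close>.\<close>

definition ref_nodes :: "nat \<Rightarrow> (real^2) set \<Rightarrow> (real^2) set" where
  "ref_nodes p K =
     (if p = 1 then vertices K else {midpoint a b |a b. a \<in> vertices K \<and> b \<in> vertices K})"

text \<open>A mesh consists of straight triangles together with the map \<open>node\<close> which sends each
  Lagrange node of the straight triangulation to the node of the isoparametric triangulation;
  it moves only midpoints of boundary edges (when \<open>p = 2\<close>), onto the circle.\<close>

record mesh =
  cells :: "(real^2) set set"
  node :: "real^2 \<Rightarrow> real^2"

definition mesh_size :: "mesh \<Rightarrow> real" where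
  "mesh_size M = Max (diameter ` cells M)"

text \<open>Bivariate polynomials of total degree at most \<open>p\<close>.\<close>

definition polys :: "nat \<Rightarrow> (real^2 \<Rightarrow> real) set" where
  "polys p = {q. \<exists>c. \<forall>x. q x = (\<Sum>(i, j)\<in>{(i, j). i + j \<le> p}. c i j * (x $ 1) ^ i * (x $ 2) ^ j)}"

text \<open>The element map of degree \<open>p\<close>, with the straight triangle \<open>K\<close> serving as reference triangle.
  It is the identity if \<open>node\<close> moves no node of \<open>K\<close>, in particular for \<open>p = 1\<close>.\<close>

definition elem_map :: "nat \<Rightarrow> mesh \<Rightarrow> (real^2) set \<Rightarrow> real^2 \<Rightarrow> real^2" where
  "elem_map p M K =
     (THE F. (\<forall>i. (\<lambda>x. F x $ i) \<in> polys p) \<and> (\<forall>a\<in>ref_nodes p K. F a = node M a))"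

definition mesh_domain :: "nat \<Rightarrow> mesh \<Rightarrow> (real^2) set" where
  "mesh_domain p M = (\<Union>K\<in>cells M. elem_map p M K ` K)"

text \<open>The union of the straight triangles is a convex polygon inscribed in the circle. As its
  boundary chords have length at most the mesh size \<open>h\<close>, it contains the concentric disk of
  radius \<open>1 - h\<close> as soon as it is not a mere circular segment; this is the requirement that it
  covers the disk. The last condition says that the (possibly curved) elements are
  non-degenerate and fit together conformingly; it is automatic for \<open>p = 1\<close>.\<close>

definition disk_mesh :: "nat \<Rightarrow> mesh \<Rightarrow> bool" where
  "disk_mesh p M \<longleftrightarrow>
     cells M \<noteq> {} \<and> triangulation (cells M) \<and> (\<forall>K\<in>cells M. 2 simplex K) \<and>
     convex (\<Union>(cells M)) \<and> ball 0 (1 - mesh_size M) \<subseteq> \<Union>(cells M) \<and>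
     (\<forall>K\<in>cells M. \<forall>a\<in>vertices K. node M a = a) \<and>
     (\<forall>K\<in>cells M. \<forall>a\<in>ref_nodes p K.
        if a \<in> frontier (\<Union>(cells M)) then node M a \<in> sphere 0 1 else node M a = a) \<and>
     (\<forall>K\<in>cells M. inj_on (elem_map p M K) K) \<and>
     (\<forall>K\<in>cells M. \<forall>L\<in>cells M.
        elem_map p M K ` K \<inter> elem_map p M L ` L = elem_map p M K ` (K \<inter> L))"

text \<open>Shape regularity, quasi-uniformity, and for \<open>p = 2\<close> the usual condition for regular
  families of isoparametric elements that boundary nodes are moved by \<open>O(h\<^sup>2)\<close> only.\<close>

definition regular_family :: "nat \<Rightarrow> mesh set \<Rightarrow> bool" where
  "regular_family p \<M> \<longleftrightarrow> (\<forall>M\<in>\<M>. disk_mesh p M) \<and>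
     (\<exists>\<sigma>>0. \<forall>M\<in>\<M>. \<forall>K\<in>cells M. \<exists>z. ball z (\<sigma> * diameter K) \<subseteq> K) \<and>
     (\<exists>\<kappa>>0. \<forall>M\<in>\<M>. \<forall>K\<in>cells M. \<kappa> * mesh_size M \<le> diameter K) \<and>
     (\<exists>C. \<forall>M\<in>\<M>. \<forall>K\<in>cells M. \<forall>a\<in>ref_nodes p K. dist (node M a) a \<le> C * (mesh_size M)\<^sup>2)"


section \<open>Finite element spaces\<close>

text \<open>Finite element functions live on \<open>mesh_domain p M\<close>. They are represented by their extension
  by zero, so that equality of functions is equality on the mesh domain. For \<open>p = 1\<close> the second
  condition says that \<open>v\<close> is a polynomial of degree at most 1 on each triangle.\<close>

definition fe_space :: "nat \<Rightarrow> mesh \<Rightarrow> (real^2 \<Rightarrow> real) set" where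
  "fe_space p M = {v. continuous_on (mesh_domain p M) v \<and>
     (\<forall>K\<in>cells M. \<exists>q\<in>polys p. \<forall>x\<in>K. v (elem_map p M K x) = q x) \<and>
     (\<forall>x. x \<notin> mesh_domain p M \<longrightarrow> v x = 0)}"

definition fe_space0 :: "nat \<Rightarrow> mesh \<Rightarrow> (real^2 \<Rightarrow> real) set" where
  "fe_space0 p M = {v \<in> fe_space p M. \<forall>x\<in>frontier (mesh_domain p M). v x = 0}"

definition vfe_space :: "nat \<Rightarrow> mesh \<Rightarrow> (real^2 \<Rightarrow> real^3) set" where
  "vfe_space p M = {v. \<forall>i. (\<lambda>x. v x $ i) \<in> fe_space p M}"

definition vfe_space0 :: "nat \<Rightarrow> mesh \<Rightarrow> (real^2 \<Rightarrow> real^3) set" where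
  "vfe_space0 p M = {v. \<forall>i. (\<lambda>x. v x $ i) \<in> fe_space0 p M}"

definition nodes :: "nat \<Rightarrow> mesh \<Rightarrow> (real^2) set" where
  "nodes p M = (\<Union>K\<in>cells M. node M ` ref_nodes p K)"

definition vfe_space_bd :: "nat \<Rightarrow> mesh \<Rightarrow> (real^2 \<Rightarrow> real^3) \<Rightarrow> (real^2 \<Rightarrow> real^3) set" where
  "vfe_space_bd p M u0 =
     {v \<in> vfe_space p M. \<forall>z\<in>nodes p M \<inter> frontier (mesh_domain p M). v z = u0 z}"

definition nodal_interp :: "nat \<Rightarrow> mesh \<Rightarrow> (real^2 \<Rightarrow> real^3) \<Rightarrow> (real^2 \<Rightarrow> real^3)" where
  "nodal_interp p M f = (THE v. v \<in> vfe_space p M \<and> (\<forall>z\<in>nodes p M. v z = f z))"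

definition bform ::
  "nat \<Rightarrow> mesh \<Rightarrow> (real^2 \<Rightarrow> real^3) \<Rightarrow> (real^2 \<Rightarrow> real^3) \<Rightarrow> (real^2 \<Rightarrow> real) \<Rightarrow> real" where
  "bform p M u v w = l2_inner (mesh_domain p M) (\<lambda>x. u x \<bullet> v x) w"

definition tangent_space :: "nat \<Rightarrow> mesh \<Rightarrow> (real^2 \<Rightarrow> real^3) \<Rightarrow> (real^2 \<Rightarrow> real^3) set" where
  "tangent_space p M u = {v \<in> vfe_space0 p M. \<forall>w\<in>fe_space0 p M. bform p M u v w = 0}"


section \<open>The tangent space BDF scheme\<close>

definition bdf :: "nat \<Rightarrow> nat \<Rightarrow> real" where
  "bdf k i = (if k = 1 then [1, - 1] ! i else [3/2, - 2, 1/2] ! i)"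

text \<open>Where the extrapolated value vanishes, the normalized extrapolation is 0 (division by zero
  in HOL). This concerns discrete solutions far from the exact one only.\<close>

definition normalized_extrap ::
  "nat \<Rightarrow> (nat \<Rightarrow> real^2 \<Rightarrow> real^3) \<Rightarrow> nat \<Rightarrow> real^2 \<Rightarrow> real^3" where
  "normalized_extrap k uh j x =
     (let y = (if k = 1 then uh (j - 1) x else 2 *\<^sub>R uh (j - 1) x - uh (j - 2) x)
      in y /\<^sub>R norm y)"

text \<open>The step from \<open>t\<^sub>j\<close> to \<open>t\<^sub>j\<^sub>+\<^sub>1\<close>; \<open>du\<close> is the discrete time derivative at the new time.\<close>

definition bdf_step ::
  "nat \<Rightarrow> nat \<Rightarrow> mesh \<Rightarrow> real \<Rightarrow> (nat \<Rightarrow> real^2 \<Rightarrow> real^3) \<Rightarrow> nat \<Rightarrow> bool" where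
  "bdf_step p k M \<tau> uh j \<longleftrightarrow>
     (let \<Omega> = mesh_domain p M; X = tangent_space p M (normalized_extrap k uh (j + 1))
      in \<exists>du\<in>X.
        (\<forall>v\<in>X. l2_inner \<Omega> du v + \<tau> / bdf k 0 * l2_inner \<Omega> (grad du) (grad v) =
           (\<Sum>i=1..k. bdf k i / bdf k 0 * l2_inner \<Omega> (grad (uh (j + 1 - i))) (grad v))) \<and>
        uh (j + 1) =
          (\<lambda>x. (\<tau> / bdf k 0) *\<^sub>R du x - (\<Sum>i=1..k. (bdf k i / bdf k 0) *\<^sub>R uh (j + 1 - i) x)))"

definition discrete_solution ::
  "nat \<Rightarrow> nat \<Rightarrow> mesh \<Rightarrow> real \<Rightarrow> nat \<Rightarrow> (real^2 \<Rightarrow> real^3) \<Rightarrow> (nat \<Rightarrow> real^2 \<Rightarrow> real^3) \<Rightarrow> bool" where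
  "discrete_solution p k M \<tau> J u0 uh \<longleftrightarrow>
     uh 0 = nodal_interp p M u0 \<and>
     (k = 2 \<longrightarrow> uh 1 \<in> vfe_space_bd p M u0 \<and> bdf_step p 1 M \<tau> uh 0) \<and>
     (\<forall>j\<in>{k - 1..<J}. bdf_step p k M \<tau> uh j)"

text \<open>The quantity \<open>\<delta>\<^sub>\<tau>\<^sub>,\<^sub>h\<close>. The exact solution is given on the disk and the discrete one on the mesh
  domain, so they are compared on the intersection, which is the mesh domain up to a null set
  if \<open>p = 1\<close>, and misses only a thin boundary layer of it if \<open>p = 2\<close>.\<close>

definition max_error ::
  "nat \<Rightarrow> mesh \<Rightarrow> real \<Rightarrow> nat \<Rightarrow> (real \<Rightarrow> real^2 \<Rightarrow> real^3) \<Rightarrow> (nat \<Rightarrow> real^2 \<Rightarrow> real^3) \<Rightarrow> ereal" where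
  "max_error p M \<tau> J u uh =
     (MAX j\<in>{0..J}. linf_norm (ball 0 1 \<inter> mesh_domain p M) (\<lambda>x. uh j x - u (real j * \<tau>) x))"

definition uniformly_convergent ::
  "nat \<Rightarrow> nat \<Rightarrow> mesh set \<Rightarrow> real \<Rightarrow> (real^2 \<Rightarrow> real^3) \<Rightarrow> (real \<Rightarrow> real^2 \<Rightarrow> real^3) \<Rightarrow> bool" where
  "uniformly_convergent p k \<M> T u0 u \<longleftrightarrow>
     (\<forall>\<epsilon>\<in>{0<..1}. \<exists>\<epsilon>1>0. \<exists>\<epsilon>2>0. \<forall>M\<in>\<M>. \<forall>\<tau>>0. \<forall>J uh.
        real J * \<tau> = T \<longrightarrow> \<tau> \<le> \<epsilon>1 \<longrightarrow> mesh_size M \<le> \<epsilon>2 \<longrightarrow>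
        discrete_solution p k M \<tau> J u0 uh \<longrightarrow>
        max_error p M \<tau> J u uh \<le> ereal \<epsilon>)"

end

theory Submission
  imports Defs
begin

text \<open>Fix a time level \<open>j\<close> and, on every element \<open>K\<close>, let \<open>c\<close> be the value of \<open>u (t\<^sub>j)\<close> at a point
  well inside \<open>K\<close>. On a fine mesh \<open>u (t\<^sub>j)\<close> is uniformly close to \<open>c\<close> on \<open>K\<close>, and so is the normalized
  extrapolation \<open>b\<close> of the discrete solution; in particular \<open>b \<bullet> c \<ge> 3/4\<close>. The trial function for a
  given \<open>w\<close> is the nodal interpolant \<open>v\<close> of \<open>w u (t\<^sub>j)\<close>. Since interpolation reproduces \<open>w c\<close> on \<open>K\<close>,
  the deviation \<open>v - w c\<close> is the interpolant of \<open>w (u (t\<^sub>j) - c)\<close> and is at most a small multiple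
  \<open>3 \<epsilon>\<close> of the maximum of \<open>\<bar>w\<bar>\<close> over \<open>K\<close>. By shape regularity the square of this maximum times the area
  of \<open>K\<close> is bounded by the integral of \<open>w\<^sup>2\<close> over \<open>K\<close> (\<open>element_max_le_l2\<close>). Hence, up to terms that are
  absorbed, \<open>(b \<bullet> v) w\<close> behaves like \<open>w\<^sup>2 (b \<bullet> c)\<close> and \<open>\<bar>v\<bar>\<close> like \<open>\<bar>w\<bar>\<close>, which gives
  \<open>(b \<bullet> v, w) \<ge> \<parallel>w\<parallel>\<^sup>2/4\<close> and \<open>\<parallel>v\<parallel> \<le> 2 \<parallel>w\<parallel>\<close> (\<open>interpolant_product_coercive\<close>), so that \<open>\<beta> = 1/8\<close> works
  for every regular family.

  Three points need care. First, for \<open>p = 2\<close> the mesh domain may stick out of the disk, where there is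
  no exact solution to compare with. But the discrete solution composed with the element map is a quadratic
  polynomial, and a quadratic polynomial that is small on a ball well inside \<open>K\<close> is small on \<open>K\<close>
  (\<open>element_close_from_ball\<close>). Second, curved elements are handled without Jacobians: the element map
  moves points by \<open>O(h\<^sup>2)\<close>, far less than the size of the element, and by Brouwer's theorem a map that
  close to the identity covers a slightly smaller ball (\<open>near_identity_covers_ball\<close>). Third, \<open>v\<close> has to
  be continuous and to vanish on the frontier. The element maps glue to a homeomorphism from the
  convex polygon formed by the straight triangles onto the mesh domain, which preserves the frontier
  by invariance of domain; a finite element function whose nodal values vanish on the frontier then
  vanishes there, because the polygon is convex (\<open>piecewise_zero_on_frontier\<close>).\<close>

section \<open>Quadratic functions\<close>

text \<open>On each line the second-degree interpolation formula through \<open>z - e\<close>, \<open>z\<close>, \<open>z + e\<close> is exact, as it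
  is for polynomials of degree at most 2. Stated this way the property makes sense for vector-valued
  maps and yields inverse estimates without reference to coefficients.\<close>

definition quadratic_on_lines :: "('a::real_vector \<Rightarrow> 'b::real_vector) \<Rightarrow> bool" where
  "quadratic_on_lines q \<longleftrightarrow> (\<forall>z e s. q (z + s *\<^sub>R e) =
     q z + (s / 2) *\<^sub>R (q (z + e) - q (z - e)) + (s\<^sup>2 / 2) *\<^sub>R (q (z + e) + q (z - e) - 2 *\<^sub>R q z))"

lemma quadratic_on_lines_diff_const:
  assumes "quadratic_on_lines q"
  shows "quadratic_on_lines (\<lambda>x. q x - c)"
proof -
  have "(a - c) + (b - c) - 2 *\<^sub>R (d - c) = a + b - 2 *\<^sub>R d" for a b d :: 'b
    by (simp add: algebra_simps scaleR_2)
  then show ?thesis using assms unfolding quadratic_on_lines_def by simp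
qed

lemma norm_line_quadratic_le:
  fixes q :: "'a::real_normed_vector \<Rightarrow> 'b::real_normed_vector"
  assumes q: "quadratic_on_lines q" and m: "norm (q z) \<le> m" "norm (q (z + e)) \<le> m" "norm (q (z - e)) \<le> m"
    and s: "0 \<le> s"
  shows "norm (q (z + s *\<^sub>R e) - q z) \<le> s * m + 2 * s\<^sup>2 * m"
proof -
  have "q (z + s *\<^sub>R e) - q z =
      (s / 2) *\<^sub>R (q (z + e) - q (z - e)) + (s\<^sup>2 / 2) *\<^sub>R (q (z + e) + q (z - e) - 2 *\<^sub>R q z)"
    using q unfolding quadratic_on_lines_def by (simp add: algebra_simps)
  also have "norm \<dots> \<le> (s / 2) * norm (q (z + e) - q (z - e))
      + (s\<^sup>2 / 2) * norm (q (z + e) + q (z - e) - 2 *\<^sub>R q z)"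
    using s by (intro order_trans[OF norm_triangle_ineq]) simp
  also have "\<dots> \<le> (s / 2) * (2 * m) + (s\<^sup>2 / 2) * (4 * m)"
  proof (intro add_mono mult_left_mono)
    show "norm (q (z + e) - q (z - e)) \<le> 2 * m"
      using norm_triangle_ineq4[of "q (z + e)" "q (z - e)"] m by simp
    have "norm (q (z + e) + q (z - e) - 2 *\<^sub>R q z)
        \<le> norm (q (z + e)) + norm (q (z - e)) + 2 * norm (q z)"
      using norm_triangle_ineq4[of "q (z + e) + q (z - e)" "2 *\<^sub>R q z"]
        norm_triangle_ineq[of "q (z + e)" "q (z - e)"] by simp
    then show "norm (q (z + e) + q (z - e) - 2 *\<^sub>R q z) \<le> 4 * m" using m by simp
  qed (use s in auto)
  finally show ?thesis by (simp add: algebra_simps)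
qed

text \<open>Along a line through the centre, \<open>q\<close> is a quadratic polynomial whose coefficients are
  controlled by its values at three points of the small ball, so it grows at most like the square
  of the distance.\<close>

lemma quadratic_growth:
  fixes q :: "'a::real_normed_vector \<Rightarrow> 'b::real_normed_vector"
  assumes q: "quadratic_on_lines q" and r: "0 < r" "r \<le> R"
    and m: "\<And>x. x \<in> cball z r \<Longrightarrow> norm (q x) \<le> m" and x: "x \<in> cball z R"
  shows "norm (q x) \<le> 4 * (R / r)\<^sup>2 * m"
proof -
  define S where "S = R / r"
  have S: "S \<ge> 1" using r by (simp add: S_def)
  have m0: "norm (q z) \<le> m" using m[of z] r by simp
  then have m_nonneg: "0 \<le> m" using norm_ge_zero order_trans by blast
  have "\<exists>e s. x = z + s *\<^sub>R e \<and> norm e = r \<and> 0 \<le> s \<and> s \<le> S \<or> x = z"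
  proof (cases "x = z")
    case False
    define s where "s = norm (x - z) / r"
    have "s > 0" using False r by (simp add: s_def)
    have "x = z + s *\<^sub>R ((1 / s) *\<^sub>R (x - z))" using \<open>s > 0\<close> by simp
    moreover have "norm ((1 / s) *\<^sub>R (x - z)) = r" using False r by (simp add: s_def)
    moreover have "s \<le> S" using x r by (simp add: s_def S_def dist_norm norm_minus_commute divide_right_mono)
    ultimately show ?thesis using \<open>s > 0\<close> by (metis less_imp_le)
  qed auto
  then consider "x = z" | e s where "x = z + s *\<^sub>R e" "norm e = r" "0 \<le> s" "s \<le> S" by blast
  then have "norm (q x) \<le> 4 * S\<^sup>2 * m"
  proof cases
    case 1
    have "1 * m \<le> (4 * S\<^sup>2) * m"
      using S m_nonneg one_le_power[OF S, of 2] by (intro mult_right_mono; linarith)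
    then show ?thesis using 1 m0 by simp
  next
    case 2
    have "norm (q (z + s *\<^sub>R e) - q z) \<le> s * m + 2 * s\<^sup>2 * m"
      using 2 m0 m[of "z + e"] m[of "z - e"] by (intro norm_line_quadratic_le[OF q]) (auto simp: dist_norm)
    moreover have "s * m \<le> S\<^sup>2 * m"
      using 2 S m_nonneg self_le_power[OF S, of 2] by (intro mult_right_mono) auto
    moreover have "s\<^sup>2 * m \<le> S\<^sup>2 * m"
      using 2 m_nonneg by (intro mult_right_mono power_mono) auto
    moreover have "1 * m \<le> S\<^sup>2 * m"
      using S m_nonneg by (intro mult_right_mono) auto
    ultimately show ?thesis
      using 2 m0 norm_triangle_sub[of "q x" "q z"] by simp
  qed
  then show ?thesis by (simp add: S_def)
qed

text \<open>The same three values bound the increments from the centre: a Markov inequality.\<close>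

lemma quadratic_lipschitz:
  fixes q :: "'a::real_normed_vector \<Rightarrow> 'b::real_normed_vector"
  assumes q: "quadratic_on_lines q" and r: "0 < r"
    and m: "\<And>x. x \<in> cball z r \<Longrightarrow> norm (q x) \<le> m" and x: "x \<in> cball z r"
  shows "norm (q x - q z) \<le> 3 * (norm (x - z) / r) * m"
proof (cases "x = z")
  case False
  define s where "s = norm (x - z) / r"
  have s: "s > 0" "s \<le> 1" using False r x by (simp_all add: s_def dist_norm norm_minus_commute)
  define e where "e = (1 / s) *\<^sub>R (x - z)"
  have x_eq: "x = z + s *\<^sub>R e" using s by (simp add: e_def)
  have "norm e = r" using False r by (simp add: s_def e_def)
  have m0: "norm (q z) \<le> m" using m[of z] r by simp
  then have m_nonneg: "0 \<le> m" using norm_ge_zero order_trans by blast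
  have "norm (q (z + s *\<^sub>R e) - q z) \<le> s * m + 2 * s\<^sup>2 * m"
    using \<open>norm e = r\<close> s m0 m[of "z + e"] m[of "z - e"]
    by (intro norm_line_quadratic_le[OF q]) (auto simp: dist_norm)
  moreover have "s\<^sup>2 * m \<le> s * m"
    using s m_nonneg by (intro mult_right_mono) (auto simp: power2_eq_square mult_left_le)
  ultimately have "norm (q x - q z) \<le> 3 * s * m" using x_eq by simp
  then show ?thesis unfolding s_def .
qed simp

section \<open>Bivariate polynomials\<close>

lemma polys_1_iff: "q \<in> polys 1 \<longleftrightarrow> (\<exists>a b c. \<forall>x. q x = a + b * x $ 1 + c * x $ 2)"
proof -
  have idx: "{(i, j). i + j \<le> (1::nat)} = {(0, 0), (1, 0), (0, 1)}" by auto
  show ?thesis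
  proof
    assume "q \<in> polys 1"
    then obtain c :: "nat \<Rightarrow> nat \<Rightarrow> real" where
      "\<forall>x. q x = (\<Sum>(i, j)\<in>{(i, j). i + j \<le> (1::nat)}. c i j * (x $ 1) ^ i * (x $ 2) ^ j)"
      unfolding polys_def by blast
    then have "\<forall>x. q x = c 0 0 + c 1 0 * x $ 1 + c 0 1 * x $ 2"
      unfolding idx by simp
    then show "\<exists>a b c. \<forall>x. q x = a + b * x $ 1 + c * x $ 2" by blast
  next
    assume "\<exists>a b c. \<forall>x. q x = a + b * x $ 1 + c * x $ 2"
    then obtain a b c where q: "\<forall>x. q x = a + b * x $ 1 + c * x $ 2" by blast
    define d :: "nat \<Rightarrow> nat \<Rightarrow> real" where
      "d = (\<lambda>i j. if (i, j) = (0, 0) then a else if (i, j) = (1, 0) then b else c)"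
    have "\<forall>x. q x = (\<Sum>(i, j)\<in>{(i, j). i + j \<le> (1::nat)}. d i j * (x $ 1) ^ i * (x $ 2) ^ j)"
      unfolding idx d_def using q by simp
    then show "q \<in> polys 1" unfolding polys_def by blast
  qed
qed

lemma polys_2_iff: "q \<in> polys 2 \<longleftrightarrow> (\<exists>a b c d e f. \<forall>x.
    q x = a + b * x $ 1 + c * x $ 2 + d * (x $ 1)\<^sup>2 + e * (x $ 1 * x $ 2) + f * (x $ 2)\<^sup>2)"
proof -
  have idx: "{(i, j). i + j \<le> (2::nat)} = {(0, 0), (1, 0), (0, 1), (2, 0), (1, 1), (0, 2)}" by auto
  show ?thesis
  proof
    assume "q \<in> polys 2"
    then obtain c :: "nat \<Rightarrow> nat \<Rightarrow> real" where
      "\<forall>x. q x = (\<Sum>(i, j)\<in>{(i, j). i + j \<le> (2::nat)}. c i j * (x $ 1) ^ i * (x $ 2) ^ j)"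
      unfolding polys_def by blast
    then have "\<forall>x. q x = c 0 0 + c 1 0 * x $ 1 + c 0 1 * x $ 2
        + c 2 0 * (x $ 1)\<^sup>2 + c 1 1 * (x $ 1 * x $ 2) + c 0 2 * (x $ 2)\<^sup>2"
      unfolding idx by simp
    then show "\<exists>a b c d e f. \<forall>x.
        q x = a + b * x $ 1 + c * x $ 2 + d * (x $ 1)\<^sup>2 + e * (x $ 1 * x $ 2) + f * (x $ 2)\<^sup>2"
      by blast
  next
    assume "\<exists>a b c d e f. \<forall>x.
        q x = a + b * x $ 1 + c * x $ 2 + d * (x $ 1)\<^sup>2 + e * (x $ 1 * x $ 2) + f * (x $ 2)\<^sup>2"
    then obtain a b c d e f where q: "\<forall>x.
        q x = a + b * x $ 1 + c * x $ 2 + d * (x $ 1)\<^sup>2 + e * (x $ 1 * x $ 2) + f * (x $ 2)\<^sup>2"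
      by blast
    define k :: "nat \<Rightarrow> nat \<Rightarrow> real" where
      "k = (\<lambda>i j. if (i, j) = (0, 0) then a else if (i, j) = (1, 0) then b
        else if (i, j) = (0, 1) then c else if (i, j) = (2, 0) then d
        else if (i, j) = (1, 1) then e else f)"
    have "\<forall>x. q x = (\<Sum>(i, j)\<in>{(i, j). i + j \<le> (2::nat)}. k i j * (x $ 1) ^ i * (x $ 2) ^ j)"
      unfolding idx k_def using q by simp
    then show "q \<in> polys 2" unfolding polys_def by blast
  qed
qed

lemma polys_1_subset_2: "polys 1 \<subseteq> polys 2"
proof
  fix q assume "q \<in> polys 1"
  then obtain a b c where "\<forall>x. q x = a + b * x $ 1 + c * x $ 2" unfolding polys_1_iff by blast
  then have "\<forall>x. q x = a + b * x $ 1 + c * x $ 2 + 0 * (x $ 1)\<^sup>2 + 0 * (x $ 1 * x $ 2) + 0 * (x $ 2)\<^sup>2"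
    by simp
  then show "q \<in> polys 2" unfolding polys_2_iff by blast
qed

lemma polys_const: "(\<lambda>x. c) \<in> polys p"
proof -
  define d where "d = (\<lambda>(i::nat) (j::nat). if (i, j) = (0, 0) then c else 0)"
  have fin: "finite {(i::nat, j::nat). i + j \<le> p}"
    by (rule finite_subset[of _ "{..p} \<times> {..p}"]) auto
  have "(\<Sum>(i, j)\<in>{(i, j). i + j \<le> p}. d i j * (x $ 1) ^ i * (x $ 2) ^ j) = c" for x :: "real^2"
  proof -
    have "(\<Sum>(i, j)\<in>{(i, j). i + j \<le> p}. d i j * (x $ 1) ^ i * (x $ 2) ^ j)
        = (\<Sum>ij\<in>{(i, j). i + j \<le> p}. if ij = (0, 0) then c else 0)"
      by (intro sum.cong) (auto simp: d_def split: if_splits)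
    also have "\<dots> = c" using fin by (simp add: sum.delta)
    finally show ?thesis .
  qed
  then show ?thesis unfolding polys_def by force
qed

lemma polys_add: "f \<in> polys p \<Longrightarrow> g \<in> polys p \<Longrightarrow> (\<lambda>x. f x + g x) \<in> polys p"
proof -
  assume "f \<in> polys p" "g \<in> polys p"
  then obtain c d :: "nat \<Rightarrow> nat \<Rightarrow> real" where
    "\<forall>x. f x = (\<Sum>(i, j)\<in>{(i, j). i + j \<le> p}. c i j * (x $ 1) ^ i * (x $ 2) ^ j)"
    "\<forall>x. g x = (\<Sum>(i, j)\<in>{(i, j). i + j \<le> p}. d i j * (x $ 1) ^ i * (x $ 2) ^ j)"
    unfolding polys_def by blast
  then have "\<forall>x. f x + g x =
      (\<Sum>(i, j)\<in>{(i, j). i + j \<le> p}. (c i j + d i j) * (x $ 1) ^ i * (x $ 2) ^ j)"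
    by (simp add: sum.distrib[symmetric] split_def algebra_simps)
  then show ?thesis
    unfolding polys_def by (intro CollectI exI[of _ "\<lambda>i j. c i j + d i j"])
qed

lemma polys_cmult: "f \<in> polys p \<Longrightarrow> (\<lambda>x. k * f x) \<in> polys p"
proof -
  assume "f \<in> polys p"
  then obtain c :: "nat \<Rightarrow> nat \<Rightarrow> real" where
    "\<forall>x. f x = (\<Sum>(i, j)\<in>{(i, j). i + j \<le> p}. c i j * (x $ 1) ^ i * (x $ 2) ^ j)"
    unfolding polys_def by blast
  then have "\<forall>x. k * f x =
      (\<Sum>(i, j)\<in>{(i, j). i + j \<le> p}. (k * c i j) * (x $ 1) ^ i * (x $ 2) ^ j)"
    by (simp add: sum_distrib_left split_def algebra_simps)
  then show ?thesis
    unfolding polys_def by (intro CollectI exI[of _ "\<lambda>i j. k * c i j"])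
qed

lemma polys_sum: "finite A \<Longrightarrow> (\<And>a. a \<in> A \<Longrightarrow> f a \<in> polys p) \<Longrightarrow> (\<lambda>x. \<Sum>a\<in>A. f a x) \<in> polys p"
  by (induction A rule: finite_induct) (auto simp: polys_const intro: polys_add)

lemma polys_1_mult: "f \<in> polys 1 \<Longrightarrow> g \<in> polys 1 \<Longrightarrow> (\<lambda>x. f x * g x) \<in> polys 2"
proof -
  assume "f \<in> polys 1" "g \<in> polys 1"
  then obtain a b c a' b' c' where "\<forall>x. f x = a + b * x $ 1 + c * x $ 2"
    "\<forall>x. g x = a' + b' * x $ 1 + c' * x $ 2" unfolding polys_1_iff by blast
  then have "\<forall>x. f x * g x = a * a' + (a * b' + b * a') * x $ 1 + (a * c' + c * a') * x $ 2
      + (b * b') * (x $ 1)\<^sup>2 + (b * c' + c * b') * (x $ 1 * x $ 2) + (c * c') * (x $ 2)\<^sup>2"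
    by (simp add: algebra_simps power2_eq_square)
  then show ?thesis unfolding polys_2_iff by blast
qed

lemma polys_quadratic_on_lines:
  assumes "p \<in> {1, 2}" "q \<in> polys p"
  shows "quadratic_on_lines q"
proof -
  have "q \<in> polys 2" using assms polys_1_subset_2 by auto
  then obtain a b c d e f where "\<forall>x.
      q x = a + b * x $ 1 + c * x $ 2 + d * (x $ 1)\<^sup>2 + e * (x $ 1 * x $ 2) + f * (x $ 2)\<^sup>2"
    unfolding polys_2_iff by blast
  then show ?thesis unfolding quadratic_on_lines_def by (simp add: power2_eq_square field_simps)
qed

lemma quadratic_on_lines_vec:
  fixes q :: "'a::real_vector \<Rightarrow> real^'n"
  assumes "\<And>i. quadratic_on_lines (\<lambda>x. q x $ i)"
  shows "quadratic_on_lines q"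
  using assms unfolding quadratic_on_lines_def by (simp add: vec_eq_iff)

lemma polys_continuous_on: "q \<in> polys p \<Longrightarrow> continuous_on S q"
proof -
  assume "q \<in> polys p"
  then obtain c where q: "\<forall>x. q x = (\<Sum>(i, j)\<in>{(i, j). i + j \<le> p}. c i j * (x $ 1) ^ i * (x $ 2) ^ j)"
    unfolding polys_def by blast
  have "continuous_on S (\<lambda>x. \<Sum>(i, j)\<in>{(i, j). i + j \<le> p}. c i j * (x $ 1) ^ i * (x $ 2) ^ j)"
    by (intro continuous_intros continuous_on_sum) (auto simp: split_def intro!: continuous_intros)
  then show ?thesis using q by (simp cong: continuous_on_cong)
qed

section \<open>Barycentric coordinates\<close>

definition triangle_corners :: "(real^2) set \<Rightarrow> bool" where
  "triangle_corners V \<longleftrightarrow> \<not> affine_dependent V \<and> card V = 3"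

text \<open>The choice picks the barycentric coordinates of the triangle spanned by \<open>V\<close>, extended to affine
  functions on the plane.\<close>

definition bary :: "(real^2) set \<Rightarrow> real^2 \<Rightarrow> real^2 \<Rightarrow> real" where
  "bary V = (SOME l. (\<forall>a\<in>V. l a \<in> polys 1) \<and> (\<forall>x. (\<Sum>a\<in>V. l a x) = 1 \<and> (\<Sum>a\<in>V. l a x *\<^sub>R a) = x))"

lemma triangle_corners_finite: "triangle_corners V \<Longrightarrow> finite V"
  unfolding triangle_corners_def by (metis card.infinite zero_neq_numeral)

lemma linear_polys_1:
  fixes f :: "real^2 \<Rightarrow> real"
  assumes "linear f"
  shows "(\<lambda>x. f (x - a)) \<in> polys 1"
proof -
  have "f (x - a) = - f a + f (axis 1 1) * x $ 1 + f (axis 2 1) * x $ 2" for x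
  proof -
    have "x = x $ 1 *\<^sub>R axis 1 1 + x $ 2 *\<^sub>R axis 2 1"
      by (simp add: vec_eq_iff forall_2 axis_def)
    then have "f x = f (x $ 1 *\<^sub>R axis 1 1 + x $ 2 *\<^sub>R axis 2 1)" by simp
    also have "\<dots> = f (axis 1 1) * x $ 1 + f (axis 2 1) * x $ 2"
      using assms by (simp add: linear_add linear_cmul)
    finally show ?thesis using assms by (simp add: linear_diff)
  qed
  then show ?thesis unfolding polys_1_iff by blast
qed

text \<open>The edge vectors from one corner form a basis of the plane; the dual basis gives the coordinates
  of the other two corners.\<close>

lemma bary_exists:
  assumes "triangle_corners V"
  shows "\<exists>l. (\<forall>a\<in>V. l a \<in> polys 1) \<and> (\<forall>x. (\<Sum>a\<in>V. l a x) = 1 \<and> (\<Sum>a\<in>V. l a x *\<^sub>R a) = x)"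
proof -
  have fin: "finite V" using assms by (rule triangle_corners_finite)
  from assms obtain a where "a \<in> V" unfolding triangle_corners_def by fastforce
  define W where "W = V - {a}"
  have V: "V = insert a W" "a \<notin> W" "finite W" using \<open>a \<in> V\<close> fin by (auto simp: W_def)
  have cardW: "card W = 2" using assms V unfolding triangle_corners_def by simp
  define S where "S = (\<lambda>w. w - a) ` W"
  have indep: "independent S"
    using assms affine_dependent_iff_dependent[of a W] V
    unfolding triangle_corners_def S_def by simp
  have "card S = 2" using cardW by (simp add: S_def card_image inj_on_def)
  then have "UNIV \<subseteq> span S"
    using card_ge_dim_independent[OF subset_UNIV indep] by simp
  then have span: "span S = UNIV" by blast
  have "\<forall>w. \<exists>f. linear f \<and> (\<forall>y\<in>S. f y = (if y = w - a then 1 else (0::real)))"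
    by (intro allI linear_independent_extend indep)
  then obtain f where lin: "\<And>w. linear (f w)"
    and f: "\<And>w y. y \<in> S \<Longrightarrow> f w y = (if y = w - a then 1 else (0::real))"
    unfolding choice_iff by blast
  have decomp: "(\<Sum>w\<in>W. f w y *\<^sub>R (w - a)) = y" for y
  proof -
    have "linear (\<lambda>y. \<Sum>w\<in>W. f w y *\<^sub>R (w - a))"
      using lin by (intro linear_compose_sum ballI linearI)
        (auto simp: linear_add linear_cmul scaleR_add_left)
    moreover have "linear (\<lambda>y::real^2. y)" by (rule linear_ident)
    moreover have "(\<Sum>w\<in>W. f w y *\<^sub>R (w - a)) = y" if y: "y \<in> S" for y
    proof -
      obtain v where v: "v \<in> W" "y = v - a" using y unfolding S_def by blast
      have "(\<Sum>w\<in>W. f w y *\<^sub>R (w - a)) = (\<Sum>w\<in>W. if w = v then v - a else 0)"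
        using f[OF y] v by (intro sum.cong) auto
      then show ?thesis using v V by (simp add: sum.delta)
    qed
    ultimately show ?thesis
      using linear_eq_on_span[of "\<lambda>y. \<Sum>w\<in>W. f w y *\<^sub>R (w - a)" "\<lambda>y. y" S y] span by auto
  qed
  define l where "l = (\<lambda>v x. if v = a then 1 - (\<Sum>w\<in>W. f w (x - a)) else f v (x - a))"
  have lW: "l w x = f w (x - a)" if "w \<in> W" for w x using that V by (auto simp: l_def)
  have la: "l a x = 1 - (\<Sum>w\<in>W. f w (x - a))" for x by (simp add: l_def)
  have "l v \<in> polys 1" if "v \<in> V" for v
  proof (cases "v = a")
    case True
    have "(\<lambda>x. 1 + (-1) * (\<Sum>w\<in>W. f w (x - a))) \<in> polys 1"
      by (intro polys_add polys_const polys_cmult polys_sum linear_polys_1 lin V)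
    then show ?thesis using True by (simp add: l_def)
  next
    case False
    then show ?thesis using linear_polys_1[OF lin] by (simp add: l_def)
  qed
  moreover have "(\<Sum>v\<in>V. l v x) = 1" for x
    using V by (simp add: la lW)
  moreover have "(\<Sum>v\<in>V. l v x *\<^sub>R v) = x" for x
  proof -
    have "(\<Sum>v\<in>V. l v x *\<^sub>R v) = a + (\<Sum>w\<in>W. f w (x - a) *\<^sub>R (w - a))"
      using V by (simp add: la lW algebra_simps sum_subtractf scaleR_sum_left)
    then show ?thesis using decomp by simp
  qed
  ultimately show ?thesis by blast
qed

lemma
  assumes "triangle_corners V"
  shows bary_polys: "a \<in> V \<Longrightarrow> bary V a \<in> polys 1"
    and sum_bary: "(\<Sum>a\<in>V. bary V a x) = 1"
    and bary_decomp: "(\<Sum>a\<in>V. bary V a x *\<^sub>R a) = x"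
  using someI_ex[OF bary_exists[OF assms]] unfolding bary_def by blast+

lemma triangle_affine_hull:
  assumes "triangle_corners V"
  shows "affine hull V = UNIV"
proof -
  have "x \<in> affine hull V" for x
    unfolding affine_hull_finite[OF triangle_corners_finite[OF assms]]
    by (intro CollectI exI[of _ "\<lambda>a. bary V a x"] conjI sum_bary[OF assms] bary_decomp[OF assms])
  then show ?thesis by blast
qed

lemma bary_unique:
  assumes V: "triangle_corners V" and c: "sum c V = 1" "(\<Sum>v\<in>V. c v *\<^sub>R v) = x" and a: "a \<in> V"
  shows "bary V a x = c a"
proof (rule ccontr)
  assume ne: "bary V a x \<noteq> c a"
  have "sum (\<lambda>v. bary V v x - c v) V = 0"
    using c sum_bary[OF V] by (simp add: sum_subtractf)
  moreover have "(\<Sum>v\<in>V. (bary V v x - c v) *\<^sub>R v) = 0"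
    using c bary_decomp[OF V] by (simp add: scaleR_left_diff_distrib sum_subtractf)
  ultimately have "affine_dependent V"
    using ne a triangle_corners_finite[OF V]
    by (auto simp: affine_dependent_explicit_finite intro!: exI[of _ "\<lambda>v. bary V v x - c v"])
  then show False using V by (simp add: triangle_corners_def)
qed

lemma bary_convex_hull:
  assumes V: "triangle_corners V" and S: "S \<subseteq> V" and x: "x \<in> convex hull S"
  shows "\<exists>c. (\<forall>a\<in>S. 0 \<le> c a) \<and> (\<forall>a\<in>V. bary V a x = (if a \<in> S then c a else 0))
    \<and> sum c S = 1 \<and> (\<Sum>a\<in>S. c a *\<^sub>R a) = x"
proof -
  have fin: "finite V" "finite S" using triangle_corners_finite[OF V] S finite_subset by auto
  obtain c where c: "\<forall>a\<in>S. 0 \<le> c a" "sum c S = 1" "(\<Sum>a\<in>S. c a *\<^sub>R a) = x"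
    using x unfolding convex_hull_finite[OF fin(2)] by blast
  have "bary V a x = (if a \<in> S then c a else 0)" if "a \<in> V" for a
  proof (rule bary_unique[OF V _ _ that, where c = "\<lambda>a. if a \<in> S then c a else 0"])
    show "(\<Sum>a\<in>V. if a \<in> S then c a else 0) = 1"
      using c fin S by (simp add: sum.inter_restrict[symmetric] Int_absorb1)
    have "(\<Sum>v\<in>V. (if v \<in> S then c v else 0) *\<^sub>R v) = (\<Sum>v\<in>V. if v \<in> S then c v *\<^sub>R v else 0)"
      by (intro sum.cong) auto
    also have "\<dots> = x"
      using c fin S by (simp add: sum.inter_restrict[symmetric] Int_absorb1)
    finally show "(\<Sum>v\<in>V. (if v \<in> S then c v else 0) *\<^sub>R v) = x" .
  qed
  then show ?thesis using c by blast
qed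

lemma bary_nonneg:
  assumes "triangle_corners V" "x \<in> convex hull V" "a \<in> V"
  shows "0 \<le> bary V a x"
proof -
  obtain c where "\<forall>a\<in>V. 0 \<le> c a" "\<forall>a\<in>V. bary V a x = (if a \<in> V then c a else 0)"
    using bary_convex_hull[OF assms(1) order_refl assms(2)] by blast
  then show ?thesis using assms(3) by metis
qed

text \<open>By uniqueness, both families of coordinates are the convex coefficients with respect to the common
  corners, extended by zero.\<close>

lemma bary_common_face:
  assumes V: "triangle_corners V" and W: "triangle_corners W" and x: "x \<in> convex hull (V \<inter> W)"
  shows "a \<in> V \<inter> W \<Longrightarrow> bary V a x = bary W a x" "a \<in> V - W \<Longrightarrow> bary V a x = 0"
proof -
  obtain c where c: "sum c (V \<inter> W) = 1" "(\<Sum>a\<in>V \<inter> W. c a *\<^sub>R a) = x"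
      "\<forall>a\<in>V. bary V a x = (if a \<in> V \<inter> W then c a else 0)"
    using bary_convex_hull[OF V _ x] by auto
  have fin: "finite W" using W by (rule triangle_corners_finite)
  have "bary W a x = (if a \<in> V \<inter> W then c a else 0)" if "a \<in> W" for a
  proof (rule bary_unique[OF W _ _ that, where c = "\<lambda>a. if a \<in> V \<inter> W then c a else 0"])
    have [simp]: "W \<inter> (V \<inter> W) = V \<inter> W" by blast
    show "(\<Sum>a\<in>W. if a \<in> V \<inter> W then c a else 0) = 1"
      using c fin by (simp only: sum.inter_restrict[symmetric]) simp
    have "(\<Sum>v\<in>W. (if v \<in> V \<inter> W then c v else 0) *\<^sub>R v) = (\<Sum>v\<in>W. if v \<in> V \<inter> W then c v *\<^sub>R v else 0)"
      by (intro sum.cong) auto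
    also have "\<dots> = x"
      using c fin by (simp only: sum.inter_restrict[symmetric]) simp
    finally show "(\<Sum>v\<in>W. (if v \<in> V \<inter> W then c v else 0) *\<^sub>R v) = x" .
  qed
  then show "a \<in> V \<inter> W \<Longrightarrow> bary V a x = bary W a x" "a \<in> V - W \<Longrightarrow> bary V a x = 0"
    using c by auto
qed


section \<open>Lagrange interpolation on a triangle\<close>

text \<open>Control values of the interpolant in Bezier form, so that both degrees share the single formula in
  \<open>lagrange\<close>. For \<open>p = 2\<close> the value \<open>2 f (m) - (f a + f b) / 2\<close> at the midpoint \<open>m\<close> is the one for
  which the quadratic attains \<open>f (m)\<close>; for \<open>p = 1\<close> the averages collapse to linear interpolation.\<close>

definition bezier_coeff :: "nat \<Rightarrow> (real^2 \<Rightarrow> 'a::real_vector) \<Rightarrow> real^2 \<Rightarrow> real^2 \<Rightarrow> 'a" where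
  "bezier_coeff p f a b = (if p = 1 then midpoint (f a) (f b)
     else 2 *\<^sub>R f (midpoint a b) - midpoint (f a) (f b))"

definition lagrange :: "nat \<Rightarrow> (real^2) set \<Rightarrow> (real^2 \<Rightarrow> 'a::real_vector) \<Rightarrow> real^2 \<Rightarrow> 'a" where
  "lagrange p V f x = (\<Sum>a\<in>V. \<Sum>b\<in>V. (bary V a x * bary V b x) *\<^sub>R bezier_coeff p f a b)"

definition lagrange_points :: "nat \<Rightarrow> (real^2) set \<Rightarrow> (real^2) set" where
  "lagrange_points p V = (if p = 1 then V else {midpoint a b |a b. a \<in> V \<and> b \<in> V})"

lemma lagrange_points_corner: "a \<in> V \<Longrightarrow> a \<in> lagrange_points p V"
  unfolding lagrange_points_def using midpoint_idem[of a] by (metis (mono_tags, lifting) mem_Collect_eq)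

lemma midpoint_in_lagrange_points: "a \<in> V \<Longrightarrow> b \<in> V \<Longrightarrow> p \<noteq> 1 \<Longrightarrow> midpoint a b \<in> lagrange_points p V"
  unfolding lagrange_points_def by auto

lemma lagrange_points_subset_hull: "lagrange_points p V \<subseteq> convex hull V"
proof -
  have "midpoint a b \<in> convex hull V" if "a \<in> V" "b \<in> V" for a b
    using that by (meson convex_contains_segment convex_convex_hull hull_inc midpoint_in_closed_segment subset_iff)
  then show ?thesis unfolding lagrange_points_def by (auto intro: hull_inc)
qed

lemma bezier_coeff_cong:
  assumes "\<And>y. y \<in> lagrange_points p V \<Longrightarrow> f y = g y" "a \<in> V" "b \<in> V"
  shows "bezier_coeff p f a b = bezier_coeff p g a b"
  using assms lagrange_points_corner[of _ V p] midpoint_in_lagrange_points[of a V b p] unfolding bezier_coeff_def by auto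

lemma lagrange_cong:
  assumes "\<And>y. y \<in> lagrange_points p V \<Longrightarrow> f y = g y"
  shows "lagrange p V f x = lagrange p V g x"
  unfolding lagrange_def by (intro sum.cong refl) (simp add: bezier_coeff_cong[OF assms])

lemma lagrange_nth: "lagrange p V f x $ i = lagrange p V (\<lambda>y. f y $ i) x"
proof -
  have "bezier_coeff p f a b $ i = bezier_coeff p (\<lambda>y. f y $ i) a b" for a b
    unfolding bezier_coeff_def by (simp add: midpoint_def)
  then show ?thesis unfolding lagrange_def by simp
qed

lemma lagrange_diff: "lagrange p V (\<lambda>y. f y - g y) x = lagrange p V f x - lagrange p V g x"
proof -
  have "bezier_coeff p (\<lambda>y. f y - g y) a b = bezier_coeff p f a b - bezier_coeff p g a b" for a b
    unfolding bezier_coeff_def by (simp add: midpoint_def algebra_simps)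
  then show ?thesis unfolding lagrange_def by (simp add: scaleR_diff_right sum_subtractf)
qed

lemma lagrange_scaleR_const: "lagrange p V (\<lambda>y. f y *\<^sub>R c) x = lagrange p V f x *\<^sub>R c"
proof -
  have "bezier_coeff p (\<lambda>y. f y *\<^sub>R c) a b = bezier_coeff p f a b *\<^sub>R c" for a b
    unfolding bezier_coeff_def by (simp add: midpoint_def scaleR_diff_left flip: scaleR_add_left)
  then show ?thesis unfolding lagrange_def by (simp add: scaleR_sum_left)
qed

lemma lagrange_polys:
  fixes f :: "real^2 \<Rightarrow> real"
  assumes p: "p \<in> {1, 2}" and V: "triangle_corners V"
  shows "lagrange p V f \<in> polys p"
proof (cases "p = 1")
  case True
  have "lagrange p V f x = (\<Sum>a\<in>V. f a * bary V a x)" for x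
  proof -
    have "lagrange p V f x = (\<Sum>a\<in>V. \<Sum>b\<in>V. (bary V a x * (bary V b x * f b) + bary V a x * f a * bary V b x) / 2)"
      unfolding lagrange_def bezier_coeff_def using True
      by (intro sum.cong refl) (simp add: midpoint_def field_simps)
    also have "\<dots> = ((\<Sum>a\<in>V. bary V a x) * (\<Sum>b\<in>V. bary V b x * f b)
        + (\<Sum>a\<in>V. bary V a x * f a) * (\<Sum>b\<in>V. bary V b x)) / 2"
      by (simp add: sum_product sum.distrib sum_divide_distrib add_divide_distrib)
    finally show ?thesis using sum_bary[OF V] by (simp add: mult.commute)
  qed
  then have "lagrange p V f = (\<lambda>x. \<Sum>a\<in>V. f a * bary V a x)" by auto
  moreover have "(\<lambda>x. \<Sum>a\<in>V. f a * bary V a x) \<in> polys 1"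
    by (intro polys_sum polys_cmult bary_polys V triangle_corners_finite)
  ultimately show ?thesis using True by (simp del: One_nat_def)
next
  case False
  then have "p = 2" using p by simp
  have "(\<lambda>x. \<Sum>a\<in>V. \<Sum>b\<in>V. bezier_coeff p f a b * (bary V a x * bary V b x)) \<in> polys 2"
    by (intro polys_sum polys_cmult polys_1_mult bary_polys V triangle_corners_finite)
  moreover have "lagrange p V f = (\<lambda>x. \<Sum>a\<in>V. \<Sum>b\<in>V. bezier_coeff p f a b * (bary V a x * bary V b x))"
    by (auto simp: lagrange_def mult.commute)
  ultimately show ?thesis using \<open>p = 2\<close> by simp
qed

lemma lagrange_continuous_on:
  fixes f :: "real^2 \<Rightarrow> 'a::real_normed_vector"
  assumes "triangle_corners V"
  shows "continuous_on S (lagrange p V f)"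
proof -
  have "continuous_on S (\<lambda>x. \<Sum>a\<in>V. \<Sum>b\<in>V. (bary V a x * bary V b x) *\<^sub>R bezier_coeff p f a b)"
    by (intro continuous_on_sum continuous_intros polys_continuous_on[OF bary_polys[OF assms]])
  then show ?thesis unfolding lagrange_def .
qed

text \<open>Polarization: for a polynomial \<open>q\<close> of degree at most \<open>p\<close>, \<open>bezier_coeff p q\<close> is the symmetric form,
  affine in each argument, whose diagonal is \<open>q\<close>. Expanding it in barycentric coordinates in both
  arguments gives \<open>q\<close> back.\<close>

lemma lagrange_reproduces:
  fixes q :: "real^2 \<Rightarrow> real"
  assumes p: "p \<in> {1, 2}" and V: "triangle_corners V" and q: "q \<in> polys p"
  shows "lagrange p V q = q"
proof
  fix x
  have "q \<in> polys 2" using p q polys_1_subset_2 by auto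
  obtain A B C D E F where q_eq: "\<And>x.
      q x = A + B * x $ 1 + C * x $ 2 + D * (x $ 1)\<^sup>2 + E * (x $ 1 * x $ 2) + F * (x $ 2)\<^sup>2"
    and p1: "p = 1 \<Longrightarrow> D = 0 \<and> E = 0 \<and> F = 0"
  proof (cases "p = 1")
    case True
    then obtain A B C where "\<forall>x. q x = A + B * x $ 1 + C * x $ 2"
      using q polys_1_iff by auto
    then show thesis using that[of A B C 0 0 0] by simp
  next
    case False
    then show thesis using \<open>q \<in> polys 2\<close> that unfolding polys_2_iff by blast
  qed
  define H where "H a b = A + (B * (a $ 1 + b $ 1) + C * (a $ 2 + b $ 2)) / 2
      + D * (a $ 1 * b $ 1) + E * (a $ 1 * b $ 2 + a $ 2 * b $ 1) / 2 + F * (a $ 2 * b $ 2)"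
    for a b :: "real^2"
  have bezier_coeff_eq: "bezier_coeff p q a b = H a b" for a b
  proof (cases "p = 1")
    case True
    then show ?thesis
      using p1 unfolding bezier_coeff_def H_def q_eq by (simp add: midpoint_def field_simps)
  next
    case False
    then show ?thesis
      unfolding bezier_coeff_def H_def q_eq by (simp add: midpoint_def field_simps power2_eq_square)
  qed
  have aff: "(\<Sum>a\<in>V. bary V a x * (\<alpha> + \<beta> * a $ 1 + \<gamma> * a $ 2)) = \<alpha> + \<beta> * x $ 1 + \<gamma> * x $ 2"
    for \<alpha> \<beta> \<gamma>
  proof -
    have x_i: "x $ i = (\<Sum>a\<in>V. bary V a x * a $ i)" for i
      using arg_cong[OF bary_decomp[OF V, of x], of "\<lambda>y. y $ i"] by simp
    have "(\<Sum>a\<in>V. bary V a x * (\<alpha> + \<beta> * a $ 1 + \<gamma> * a $ 2))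
        = \<alpha> * (\<Sum>a\<in>V. bary V a x) + \<beta> * (\<Sum>a\<in>V. bary V a x * a $ 1) + \<gamma> * (\<Sum>a\<in>V. bary V a x * a $ 2)"
      by (simp add: sum_distrib_left sum.distrib algebra_simps)
    then show ?thesis using sum_bary[OF V] x_i by simp
  qed
  have left: "(\<Sum>a\<in>V. bary V a x * H a b) = H x b" for b
    using aff[of "A + (B * b $ 1 + C * b $ 2) / 2" "B / 2 + D * b $ 1 + E * b $ 2 / 2"
        "C / 2 + E * b $ 1 / 2 + F * b $ 2"]
    unfolding H_def by (simp add: algebra_simps add_divide_distrib)
  have H_sym: "H a b = H b a" for a b unfolding H_def by (simp add: algebra_simps)
  have "lagrange p V q x = (\<Sum>a\<in>V. bary V a x * (\<Sum>b\<in>V. bary V b x * H b a))"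
    unfolding lagrange_def bezier_coeff_eq by (simp add: sum_distrib_left H_sym mult.assoc)
  also have "\<dots> = (\<Sum>a\<in>V. bary V a x * H a x)"
    by (rule sum.cong[OF refl]) (metis left H_sym)
  also have "\<dots> = H x x" by (rule left)
  also have "\<dots> = q x" unfolding H_def q_eq by (simp add: power2_eq_square algebra_simps)
  finally show "lagrange p V q x = q x" .
qed

text \<open>At the midpoint of \<open>a\<close> and \<open>b\<close> only these two corners have nonzero barycentric coordinates,
  namely \<open>1/2\<close> each (or 1 if \<open>a = b\<close>).\<close>

lemma lagrange_at_points:
  assumes V: "triangle_corners V" and y: "y \<in> lagrange_points p V"
  shows "lagrange p V f y = f y"
proof -
  obtain a b where ab: "a \<in> V" "b \<in> V" "y = midpoint a b" "p = 1 \<Longrightarrow> a = b"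
    using y unfolding lagrange_points_def by (auto split: if_splits intro: that[of y y])
  have fin: "finite V" using V by (rule triangle_corners_finite)
  have l: "bary V v y = ((if v = a then 1 else 0) + (if v = b then 1 else 0)) / 2" if "v \<in> V" for v
  proof (rule bary_unique[OF V _ _ that,
      where c = "\<lambda>v. ((if v = a then 1 else 0) + (if v = b then 1 else 0)) / 2"])
    show "(\<Sum>v\<in>V. ((if v = a then 1 else 0) + (if v = b then 1 else 0)) / 2) = (1::real)"
      using ab fin by (simp add: sum.distrib sum_divide_distrib[symmetric] sum.delta)
    have "(\<Sum>v\<in>V. (((if v = a then 1 else 0) + (if v = b then 1 else 0)) / 2) *\<^sub>R v)
        = (\<Sum>v\<in>V. (if v = a then (1/2) *\<^sub>R a else 0) + (if v = b then (1/2) *\<^sub>R b else 0))"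
      by (intro sum.cong) (auto simp: scaleR_add_left[symmetric])
    also have "\<dots> = y" using ab fin by (simp add: sum.distrib sum.delta midpoint_def scaleR_add_right)
    finally show "(\<Sum>v\<in>V. (((if v = a then 1 else 0) + (if v = b then 1 else 0)) / 2) *\<^sub>R v) = y" .
  qed
  have pick: "(\<Sum>v\<in>V. bary V v y *\<^sub>R g v) = (1/2) *\<^sub>R (g a + g b)" for g :: "real^2 \<Rightarrow> 'a"
  proof -
    have "(\<Sum>v\<in>V. bary V v y *\<^sub>R g v)
        = (\<Sum>v\<in>V. (if v = a then (1/2) *\<^sub>R g a else 0) + (if v = b then (1/2) *\<^sub>R g b else 0))"
      by (intro sum.cong refl) (auto simp: l scaleR_add_left[symmetric])
    then show ?thesis using ab fin by (simp add: sum.distrib sum.delta scaleR_add_right)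
  qed
  have four: "v + v + v + v = 4 *\<^sub>R v" for v :: 'a
  proof -
    have "v + v + (v + v) = (2 + 2) *\<^sub>R v" by (simp only: scaleR_add_left scaleR_2)
    then show ?thesis by (simp add: add.assoc)
  qed
  have "lagrange p V f y = (\<Sum>v\<in>V. bary V v y *\<^sub>R (\<Sum>w\<in>V. bary V w y *\<^sub>R bezier_coeff p f v w))"
    unfolding lagrange_def by (simp add: scaleR_sum_right)
  also have "\<dots> = (1/4) *\<^sub>R (bezier_coeff p f a a + bezier_coeff p f a b + bezier_coeff p f b a + bezier_coeff p f b b)"
    unfolding pick by (simp add: scaleR_add_right)
  also have "\<dots> = f y"
  proof (cases "p = 1")
    case True
    then show ?thesis
      using ab four[of "f y"] by (simp add: bezier_coeff_def)
  next
    case False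
    have "bezier_coeff p f a a + bezier_coeff p f a b + bezier_coeff p f b a + bezier_coeff p f b b = 4 *\<^sub>R f y"
    proof -
      define m where "m = (1/2) *\<^sub>R (f a + f b)"
      have corners: "bezier_coeff p f a a = f a" "bezier_coeff p f b b = f b"
        using False by (simp_all add: bezier_coeff_def scaleR_2)
      have edge: "bezier_coeff p f a b = 2 *\<^sub>R f y - m" "bezier_coeff p f b a = 2 *\<^sub>R f y - m"
        using False ab by (simp_all add: bezier_coeff_def midpoint_def add.commute m_def)
      have sum: "f a + f b = m + m"
        unfolding m_def scaleR_add_left[symmetric] by simp
      have "bezier_coeff p f a a + bezier_coeff p f a b + bezier_coeff p f b a + bezier_coeff p f b b
          = (f a + f b) + (2 *\<^sub>R f y - m + (2 *\<^sub>R f y - m))"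
        unfolding corners edge by (simp add: algebra_simps)
      also have "\<dots> = 2 *\<^sub>R f y + 2 *\<^sub>R f y" unfolding sum by simp
      also have "\<dots> = 4 *\<^sub>R f y"
        unfolding scaleR_add_left[symmetric] by simp
      finally show ?thesis .
    qed
    then show ?thesis by simp
  qed
  finally show ?thesis .
qed

text \<open>The barycentric weights form a convex combination, and a control value is at most \<open>2 m + m\<close>.\<close>

lemma lagrange_bound:
  fixes f :: "real^2 \<Rightarrow> 'a::real_normed_vector"
  assumes V: "triangle_corners V" and x: "x \<in> convex hull V"
    and m: "\<And>y. y \<in> lagrange_points p V \<Longrightarrow> norm (f y) \<le> m"
  shows "norm (lagrange p V f x) \<le> 3 * m"
proof -
  have b: "norm (bezier_coeff p f a b) \<le> 3 * m" if "a \<in> V" "b \<in> V" for a b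
  proof -
    have ab: "norm (f a) \<le> m" "norm (f b) \<le> m"
      using m that lagrange_points_corner by blast+
    have "norm (midpoint (f a) (f b)) \<le> (norm (f a) + norm (f b)) / 2"
      using norm_triangle_ineq[of "f a" "f b"] by (simp add: midpoint_def)
    then have mid: "norm (midpoint (f a) (f b)) \<le> m" using ab by simp
    show ?thesis
    proof (cases "p = 1")
      case True
      then show ?thesis
        using mid order_trans[OF norm_ge_zero mid] by (simp add: bezier_coeff_def)
    next
      case False
      have "norm (f (midpoint a b)) \<le> m" using m midpoint_in_lagrange_points that False by blast
      then show ?thesis
        using False mid norm_triangle_ineq4[of "2 *\<^sub>R f (midpoint a b)" "midpoint (f a) (f b)"]
        by (simp add: bezier_coeff_def)
    qed
  qed
  have "norm (lagrange p V f x) \<le> (\<Sum>a\<in>V. \<Sum>b\<in>V. (bary V a x * bary V b x) * (3 * m))"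
    unfolding lagrange_def
    by (intro order_trans[OF norm_sum] sum_mono)
      (auto intro!: mult_mono b bary_nonneg[OF V x] simp: abs_mult bary_nonneg[OF V x])
  also have "\<dots> = (\<Sum>a\<in>V. bary V a x) * (\<Sum>b\<in>V. bary V b x) * (3 * m)"
    by (simp add: sum_distrib_left sum_distrib_right mult_ac)
  also have "\<dots> = 3 * m" using sum_bary[OF V] by simp
  finally show ?thesis .
qed

text \<open>Conformity: the barycentric coordinates of the corners off the common face vanish on it, so only data
  on that face enter.\<close>

lemma lagrange_common_face:
  assumes V: "triangle_corners V" and W: "triangle_corners W" and x: "x \<in> convex hull (V \<inter> W)"
  shows "lagrange p V f x = lagrange p W f x"
proof -
  have reduce: "lagrange p V f x = (\<Sum>a\<in>V \<inter> W. \<Sum>b\<in>V \<inter> W. (bary V a x * bary V b x) *\<^sub>R bezier_coeff p f a b)"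
    if V: "triangle_corners V" and W: "triangle_corners W" and x: "x \<in> convex hull (V \<inter> W)" for V W
  proof -
    have fin: "finite V" using V by (rule triangle_corners_finite)
    have z: "bary V a x = 0" if "a \<in> V - V \<inter> W" for a
      using bary_common_face(2)[OF V W x] that by blast
    have "(\<Sum>b\<in>V. (bary V a x * bary V b x) *\<^sub>R bezier_coeff p f a b)
        = (\<Sum>b\<in>V \<inter> W. (bary V a x * bary V b x) *\<^sub>R bezier_coeff p f a b)" for a
      by (rule sum.mono_neutral_right) (use fin z in auto)
    moreover have "(\<Sum>a\<in>V. \<Sum>b\<in>V \<inter> W. (bary V a x * bary V b x) *\<^sub>R bezier_coeff p f a b)
        = (\<Sum>a\<in>V \<inter> W. \<Sum>b\<in>V \<inter> W. (bary V a x * bary V b x) *\<^sub>R bezier_coeff p f a b)"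
      by (rule sum.mono_neutral_right) (use fin z in auto)
    ultimately show ?thesis unfolding lagrange_def by simp
  qed
  have "lagrange p V f x = (\<Sum>a\<in>W \<inter> V. \<Sum>b\<in>W \<inter> V. (bary V a x * bary V b x) *\<^sub>R bezier_coeff p f a b)"
    unfolding reduce[OF V W x] by (simp add: Int_commute)
  also have "\<dots> = (\<Sum>a\<in>W \<inter> V. \<Sum>b\<in>W \<inter> V. (bary W a x * bary W b x) *\<^sub>R bezier_coeff p f a b)"
    using bary_common_face(1)[OF V W x] by (intro sum.cong) auto
  also have "\<dots> = lagrange p W f x"
    using reduce[OF W V] x by (simp add: Int_commute)
  finally show ?thesis .
qed

section \<open>The isoparametric map of a mesh\<close>

locale disk_triangulation =
  fixes p :: nat and M :: mesh
  assumes p: "p \<in> {1, 2}" and mesh: "disk_mesh p M"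
begin

abbreviation polygon :: "(real^2) set" where "polygon \<equiv> \<Union>(cells M)"

abbreviation domain :: "(real^2) set" where "domain \<equiv> mesh_domain p M"

lemma
  shows triang: "triangulation (cells M)"
    and cells_simplex: "\<forall>K\<in>cells M. 2 simplex K"
    and polygon_convex: "convex polygon"
    and polygon_covers: "ball 0 (1 - mesh_size M) \<subseteq> polygon"
    and node_vertex: "\<forall>K\<in>cells M. \<forall>a\<in>vertices K. node M a = a"
    and node_cases: "\<forall>K\<in>cells M. \<forall>a\<in>ref_nodes p K.
      if a \<in> frontier polygon then node M a \<in> sphere 0 1 else node M a = a"
    and elem_map_inj: "\<forall>K\<in>cells M. inj_on (elem_map p M K) K"
    and elem_map_meet: "\<forall>K\<in>cells M. \<forall>L\<in>cells M.
      elem_map p M K ` K \<inter> elem_map p M L ` L = elem_map p M K ` (K \<inter> L)"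
  using mesh[unfolded disk_mesh_def] by - (elim conjE, assumption)+

lemma finite_cells: "finite (cells M)"
  using triang unfolding triangulation_def by blast

lemma cell_triangle:
  assumes "K \<in> cells M"
  shows "triangle_corners (vertices K)" "K = convex hull (vertices K)"
proof -
  have "2 simplex K" using cells_simplex assms by blast
  then obtain C where C: "\<not> affine_dependent C" "int (card C) = 3" "K = convex hull C"
    unfolding simplex_def by auto
  have "vertices K = C"
    unfolding vertices_def using C extreme_point_of_convex_hull_affine_independent by auto
  then show "triangle_corners (vertices K)" "K = convex hull (vertices K)"
    using C unfolding triangle_corners_def by simp_all
qed

lemma cell_compact: "K \<in> cells M \<Longrightarrow> compact K"
  using cell_triangle triangle_corners_finite finite_imp_compact compact_convex_hull by metis

lemma cell_convex: "K \<in> cells M \<Longrightarrow> convex K"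
  using cell_triangle(2) convex_convex_hull by metis

lemma ref_nodes_eq: "ref_nodes p K = lagrange_points p (vertices K)"
  unfolding ref_nodes_def lagrange_points_def ..

lemma ref_nodes_in_cell: "K \<in> cells M \<Longrightarrow> a \<in> ref_nodes p K \<Longrightarrow> a \<in> K"
  using lagrange_points_subset_hull cell_triangle(2) unfolding ref_nodes_eq by blast

text \<open>Extreme points of a common face are corners of both triangles, and the face is their convex hull.\<close>

lemma cells_meet_in_face:
  assumes "K \<in> cells M" "L \<in> cells M" "x \<in> K" "x \<in> L"
  shows "x \<in> convex hull (vertices K \<inter> vertices L)"
proof -
  have face: "K \<inter> L face_of K" "K \<inter> L face_of L"
    using triang assms unfolding triangulation_def by (metis Int_commute)+
  have "compact (K \<inter> L)" "convex (K \<inter> L)"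
    using assms cell_compact cell_convex by (auto intro: compact_Int convex_Int)
  then have "K \<inter> L = convex hull {x. x extreme_point_of (K \<inter> L)}"
    by (rule Krein_Milman_Minkowski)
  moreover have "{x. x extreme_point_of (K \<inter> L)} \<subseteq> vertices K \<inter> vertices L"
    using extreme_point_of_face[OF face(1)] extreme_point_of_face[OF face(2)]
    unfolding vertices_def by blast
  ultimately show ?thesis using assms hull_mono by blast
qed

text \<open>The choice of the triangle is immaterial, since interpolants agree on common faces
  (\<open>piecewise_eq\<close>).\<close>

definition piecewise :: "(real^2 \<Rightarrow> 'a::real_vector) \<Rightarrow> real^2 \<Rightarrow> 'a" where
  "piecewise f x = lagrange p (vertices (SOME K. K \<in> cells M \<and> x \<in> K)) f x"

lemma piecewise_eq:
  assumes "K \<in> cells M" "x \<in> K"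
  shows "piecewise f x = lagrange p (vertices K) f x"
proof -
  define L where "L = (SOME K. K \<in> cells M \<and> x \<in> K)"
  have L: "L \<in> cells M" "x \<in> L"
    using someI[of "\<lambda>K. K \<in> cells M \<and> x \<in> K", OF conjI, OF assms] unfolding L_def by auto
  show ?thesis
    unfolding piecewise_def L_def[symmetric]
    by (rule lagrange_common_face) (use L assms cell_triangle cells_meet_in_face in auto)
qed

lemma piecewise_at_node:
  assumes "K \<in> cells M" "a \<in> ref_nodes p K"
  shows "piecewise f a = f a"
  using assms piecewise_eq[OF assms(1) ref_nodes_in_cell[OF assms]]
    lagrange_at_points[OF cell_triangle(1)] ref_nodes_eq by metis

lemma piecewise_continuous_on:
  fixes f :: "real^2 \<Rightarrow> 'a::real_normed_vector"
  shows "continuous_on polygon (piecewise f)"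
proof -
  have "continuous_on (\<Union>K\<in>cells M. K) (piecewise f)"
  proof (rule continuous_on_closed_Union)
    fix K assume K: "K \<in> cells M"
    show "closed K" using K cell_compact compact_imp_closed by blast
    show "continuous_on K (piecewise f)"
      by (subst continuous_on_cong[OF refl piecewise_eq[OF K]])
        (auto intro: lagrange_continuous_on cell_triangle K)
  qed (rule finite_cells)
  then show ?thesis by simp
qed

text \<open>Unisolvence: the Lagrange interpolant of the displaced nodes meets both conditions in the definition
  of the element map, and any other map meeting them is reproduced by interpolation.\<close>

lemma elem_map_eq:
  assumes K: "K \<in> cells M"
  shows "elem_map p M K = lagrange p (vertices K) (node M)"
  unfolding elem_map_def
proof (rule the_equality)
  note V = cell_triangle(1)[OF K]
  show "(\<forall>i. (\<lambda>x. lagrange p (vertices K) (node M) x $ i) \<in> polys p) \<and>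
      (\<forall>a\<in>ref_nodes p K. lagrange p (vertices K) (node M) a = node M a)"
    by (simp add: lagrange_nth lagrange_polys[OF p V] lagrange_at_points[OF V] ref_nodes_eq)
  fix F :: "real^2 \<Rightarrow> real^2"
  assume F: "(\<forall>i. (\<lambda>x. F x $ i) \<in> polys p) \<and> (\<forall>a\<in>ref_nodes p K. F a = node M a)"
  show "F = lagrange p (vertices K) (node M)"
  proof
    fix x
    have "F x $ i = lagrange p (vertices K) (node M) x $ i" for i
    proof -
      have "(\<lambda>x. F x $ i) \<in> polys p" using F by blast
      from lagrange_reproduces[OF p V this]
      have "F x $ i = lagrange p (vertices K) (\<lambda>y. F y $ i) x" by metis
      also have "\<dots> = lagrange p (vertices K) (\<lambda>y. node M y $ i) x"
        by (rule lagrange_cong) (use F ref_nodes_eq in auto)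
      finally show ?thesis by (simp add: lagrange_nth)
    qed
    then show "F x = lagrange p (vertices K) (node M) x" by (simp add: vec_eq_iff)
  qed
qed

text \<open>As the element maps interpolate the displaced nodes, this glues them to one map from the polygon of
  straight triangles onto the mesh domain.\<close>

definition isoparam :: "real^2 \<Rightarrow> real^2" where
  "isoparam = piecewise (node M)"

lemma isoparam_eq: "K \<in> cells M \<Longrightarrow> x \<in> K \<Longrightarrow> isoparam x = elem_map p M K x"
  unfolding isoparam_def by (simp add: elem_map_eq piecewise_eq)

lemma isoparam_node: "K \<in> cells M \<Longrightarrow> a \<in> ref_nodes p K \<Longrightarrow> isoparam a = node M a"
  unfolding isoparam_def by (rule piecewise_at_node)

lemma isoparam_continuous_on: "continuous_on polygon isoparam"
  unfolding isoparam_def by (rule piecewise_continuous_on)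

lemma isoparam_image: "isoparam ` polygon = domain"
  unfolding mesh_domain_def using isoparam_eq by (auto simp: image_iff) metis+

text \<open>Equal images lie in the image of the common face of both triangles, on which each element map is
  injective.\<close>

lemma isoparam_inj_on: "inj_on isoparam polygon"
proof (rule inj_onI)
  fix x y assume "x \<in> polygon" "y \<in> polygon" and eq: "isoparam x = isoparam y"
  then obtain K L where KL: "K \<in> cells M" "x \<in> K" "L \<in> cells M" "y \<in> L" by blast
  have inj: "inj_on (elem_map p M K) K" "inj_on (elem_map p M L) L"
    and meet: "elem_map p M K ` K \<inter> elem_map p M L ` L = elem_map p M K ` (K \<inter> L)"
    using elem_map_inj elem_map_meet KL by blast+
  have "elem_map p M K x \<in> elem_map p M K ` K \<inter> elem_map p M L ` L"
    using KL eq isoparam_eq by (metis IntI imageI)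
  then obtain z where z: "z \<in> K \<inter> L" "elem_map p M K x = elem_map p M K z"
    unfolding meet by blast
  then have "x = z" using inj(1) KL by (auto dest: inj_onD)
  then have "x \<in> L" using z by simp
  moreover have "elem_map p M L x = elem_map p M L y"
    using eq isoparam_eq[OF KL(3) \<open>x \<in> L\<close>] isoparam_eq[OF KL(3,4)] by simp
  ultimately have "elem_map p M L x = elem_map p M L y" "x \<in> L" by simp_all
  then show "x = y" using inj(2) KL by (auto dest: inj_onD)
qed

lemma polygon_compact: "compact polygon"
  using finite_cells cell_compact by blast

lemma domain_compact: "compact domain"
  using isoparam_image isoparam_continuous_on polygon_compact compact_continuous_image by metis

lemma isoparam_open_image:
  assumes "open U" "U \<subseteq> polygon"
  shows "open (isoparam ` U)"
  using assms invariance_of_domain continuous_on_subset[OF isoparam_continuous_on]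
    inj_on_subset[OF isoparam_inj_on] by blast

text \<open>Invariance of domain, for the isoparametric map and for its continuous inverse.\<close>

lemma isoparam_interior: "isoparam ` interior polygon = interior domain"
proof
  show "isoparam ` interior polygon \<subseteq> interior domain"
    using isoparam_open_image[OF open_interior interior_subset] isoparam_image interior_subset
    by (intro interior_maximal) blast+
  define g where "g = the_inv_into polygon isoparam"
  have g: "continuous_on domain g"
    using continuous_on_inv_into[OF isoparam_continuous_on polygon_compact isoparam_inj_on]
    unfolding g_def isoparam_image .
  have gy: "g y \<in> polygon" "isoparam (g y) = y" if "y \<in> domain" for y
    using that isoparam_image the_inv_into_into[OF isoparam_inj_on, of y polygon]
      f_the_inv_into_f[OF isoparam_inj_on, of y] unfolding g_def by auto
  have sub: "interior domain \<subseteq> domain" by (rule interior_subset)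
  have "inj_on g (interior domain)"
    using gy sub by (metis inj_onI subset_iff)
  then have "open (g ` interior domain)"
    using invariance_of_domain[OF continuous_on_subset[OF g sub] open_interior] by blast
  moreover have "g ` interior domain \<subseteq> polygon" using gy sub by blast
  ultimately have "g ` interior domain \<subseteq> interior polygon" by (rule interior_maximal[rotated])
  then show "interior domain \<subseteq> isoparam ` interior polygon"
    using gy(2)[OF subsetD[OF sub]] by (force simp: image_subset_iff image_iff)
qed

lemma isoparam_frontier:
  assumes "x \<in> polygon"
  shows "isoparam x \<in> frontier domain \<longleftrightarrow> x \<in> frontier polygon"
proof -
  have "isoparam x \<in> interior domain \<longleftrightarrow> x \<in> interior polygon"
    using isoparam_interior inj_on_image_mem_iff[OF isoparam_inj_on assms interior_subset] by metis
  moreover have "isoparam x \<in> domain" using assms isoparam_image by blast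
  moreover have "closed domain" "closed polygon"
    using domain_compact polygon_compact compact_imp_closed by blast+
  ultimately show ?thesis using assms by (simp add: frontier_def)
qed

text \<open>An extreme point of the polygon is a corner of a triangle and lies on the frontier, hence on the
  circle; the polygon is the convex hull of these points.\<close>

lemma polygon_subset_disk: "polygon \<subseteq> cball 0 1"
proof -
  have "x \<in> cball 0 1" if x: "x extreme_point_of polygon" for x
  proof -
    obtain K where K: "K \<in> cells M" "x \<in> K"
      using x unfolding extreme_point_of_def by blast
    have "x \<in> vertices K"
      using x K unfolding extreme_point_of_def vertices_def by blast
    then have "x \<in> ref_nodes p K" unfolding ref_nodes_eq by (rule lagrange_points_corner)
    moreover have "x \<in> frontier polygon"
      using K extreme_point_not_in_interior[OF x] closure_subset[of polygon]
      unfolding frontier_def by blast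
    ultimately have "node M x \<in> sphere 0 1"
      using bspec[OF bspec[OF node_cases K(1)], of x] by simp
    moreover have "node M x = x"
      using node_vertex K \<open>x \<in> vertices K\<close> by blast
    ultimately show ?thesis by auto
  qed
  then have "convex hull {x. x extreme_point_of polygon} \<subseteq> cball 0 1"
    by (intro hull_minimal) auto
  then show ?thesis
    using Krein_Milman_Minkowski[OF polygon_compact polygon_convex] by simp
qed

lemma node_in_disk:
  assumes "K \<in> cells M" "a \<in> ref_nodes p K"
  shows "node M a \<in> cball 0 1"
proof (cases "a \<in> frontier polygon")
  case True
  then have "node M a \<in> sphere 0 1"
    using bspec[OF bspec[OF node_cases assms(1)] assms(2)] by simp
  then show ?thesis by auto
next
  case False
  then have "node M a = a"
    using bspec[OF bspec[OF node_cases assms(1)] assms(2)] by simp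
  then show ?thesis using polygon_subset_disk ref_nodes_in_cell[OF assms] assms by auto
qed

text \<open>A face that meets the interior of a triangle is the whole triangle.\<close>

lemma interior_cells_disjoint:
  assumes "K \<in> cells M" "L \<in> cells M" "x \<in> interior K" "x \<in> L"
  shows "K = L"
proof -
  have "K \<inter> L face_of K" "K \<inter> L face_of L"
    using triang assms unfolding triangulation_def by (metis Int_commute)+
  have "K \<inter> L = K"
    using face_of_disjoint_interior[OF \<open>K \<inter> L face_of K\<close>] assms interior_subset by blast
  then have "x \<in> interior L" using assms interior_mono[of K L] by blast
  then have "K \<inter> L = L"
    using face_of_disjoint_interior[OF \<open>K \<inter> L face_of L\<close>] assms interior_subset by blast
  then show ?thesis using \<open>K \<inter> L = K\<close> by simp
qed

text \<open>At a frontier point of the convex polygon, the corners with nonzero barycentric coordinate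
  all lie on one supporting line, hence so do the nodes that determine the value there.\<close>

lemma piecewise_zero_on_frontier:
  fixes f :: "real^2 \<Rightarrow> 'a::real_vector"
  assumes x: "x \<in> polygon" "x \<in> frontier polygon"
    and f: "\<And>K a. K \<in> cells M \<Longrightarrow> a \<in> ref_nodes p K \<Longrightarrow> a \<in> frontier polygon \<Longrightarrow> f a = 0"
  shows "piecewise f x = 0"
proof -
  obtain K where K: "K \<in> cells M" "x \<in> K" using x by blast
  define V where "V = vertices K"
  have V: "triangle_corners V" "K = convex hull V" using cell_triangle[OF K(1)] by (simp_all add: V_def)
  have fin: "finite V" using V by (simp add: triangle_corners_finite)
  have "affine hull polygon = UNIV"
    using triangle_affine_hull[OF V(1)] hull_mono[of V polygon affine] V(2) hull_subset[of V convex] K(1)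
    by blast
  then have ri: "rel_interior polygon = interior polygon" by (rule rel_interior_interior)
  have closed: "closed polygon" using polygon_compact compact_imp_closed by blast
  obtain n where n: "n \<noteq> 0" "\<And>y. y \<in> polygon \<Longrightarrow> n \<bullet> x \<le> n \<bullet> y"
  proof (rule supporting_hyperplane_relative_frontier[OF polygon_convex])
    show "x \<in> closure polygon" "x \<notin> rel_interior polygon"
      using x(2) unfolding ri frontier_def by simp_all
  qed (use closed that in auto)
  have on_line: "y \<in> frontier polygon" if y: "y \<in> polygon" "n \<bullet> y = n \<bullet> x" for y
  proof (rule ccontr)
    assume "y \<notin> frontier polygon"
    then have "y \<in> interior polygon"
      using y closure_subset[of polygon] unfolding frontier_def by blast
    then obtain e where e: "e > 0" "ball y e \<subseteq> polygon" by (meson mem_interior)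
    define s where "s = e / (2 * norm n)"
    have "s > 0" using e n by (simp add: s_def)
    have "dist y (y - s *\<^sub>R n) < e" using e n by (simp add: s_def dist_norm)
    then have "n \<bullet> x \<le> n \<bullet> (y - s *\<^sub>R n)" using e n(2) by (meson mem_ball subset_iff)
    then have "s * (n \<bullet> n) \<le> 0" using y by (simp add: inner_diff_right)
    moreover have "n \<bullet> n > 0" using n(1) by simp
    ultimately show False using \<open>s > 0\<close> by (simp add: mult_le_0_iff)
  qed
  have sub: "V \<subseteq> polygon" using V(2) K hull_subset[of V convex] by blast
  have nonneg: "0 \<le> bary V a x" if "a \<in> V" for a
    using bary_nonneg[OF V(1) _ that] V(2) K(2) by blast
  have "(\<Sum>a\<in>V. bary V a x * (n \<bullet> a - n \<bullet> x)) = n \<bullet> (\<Sum>a\<in>V. bary V a x *\<^sub>R a) - (\<Sum>a\<in>V. bary V a x) * (n \<bullet> x)"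
    by (simp add: inner_sum_right right_diff_distrib sum_subtractf sum_distrib_right)
  also have "\<dots> = 0" using sum_bary[OF V(1)] bary_decomp[OF V(1)] by simp
  finally have "(\<Sum>a\<in>V. bary V a x * (n \<bullet> a - n \<bullet> x)) = 0" .
  moreover have "0 \<le> bary V a x * (n \<bullet> a - n \<bullet> x)" if "a \<in> V" for a
    using nonneg[OF that] n(2)[OF subsetD[OF sub that]] by simp
  ultimately have "\<forall>a\<in>V. bary V a x * (n \<bullet> a - n \<bullet> x) = 0"
    using sum_nonneg_eq_0_iff[OF fin, of "\<lambda>a. bary V a x * (n \<bullet> a - n \<bullet> x)"] by blast
  then have active: "n \<bullet> a = n \<bullet> x" if "a \<in> V" "bary V a x \<noteq> 0" for a
    using that by auto
  have "(bary V a x * bary V b x) *\<^sub>R bezier_coeff p f a b = 0" if ab: "a \<in> V" "b \<in> V" for a b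
  proof (cases "bary V a x = 0 \<or> bary V b x = 0")
    case False
    then have eq: "n \<bullet> a = n \<bullet> x" "n \<bullet> b = n \<bullet> x" using active ab by auto
    have f0: "f y = 0" if "y \<in> lagrange_points p V" "n \<bullet> y = n \<bullet> x" for y
    proof -
      have y: "y \<in> ref_nodes p K" using that(1) unfolding ref_nodes_eq V_def .
      then have "y \<in> polygon" using ref_nodes_in_cell[OF K(1)] K(1) by blast
      then show ?thesis using f[OF K(1) y] on_line that(2) by blast
    qed
    have "n \<bullet> midpoint a b = n \<bullet> x" using eq by (simp add: midpoint_def inner_add_right)
    then have "p \<noteq> 1 \<Longrightarrow> f (midpoint a b) = 0" using f0 midpoint_in_lagrange_points[OF ab] by blast
    moreover have "f a = 0" "f b = 0" using f0 lagrange_points_corner ab eq by blast+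
    ultimately have "bezier_coeff p f a b = 0" by (simp add: bezier_coeff_def midpoint_def[of 0])
    then show ?thesis by simp
  qed auto
  then show ?thesis
    unfolding piecewise_eq[OF K] V_def[symmetric] lagrange_def by (simp add: sum.neutral)
qed

end

section \<open>Finite element functions and nodal interpolation\<close>

lemma fe_space_add:
  assumes "v \<in> fe_space p M" "w \<in> fe_space p M"
  shows "(\<lambda>x. v x + w x) \<in> fe_space p M"
proof -
  have "\<exists>q\<in>polys p. \<forall>x\<in>K. v (elem_map p M K x) + w (elem_map p M K x) = q x" if K: "K \<in> cells M" for K
  proof -
    obtain q r where "q \<in> polys p" "\<forall>x\<in>K. v (elem_map p M K x) = q x"
      "r \<in> polys p" "\<forall>x\<in>K. w (elem_map p M K x) = r x"
      using assms K unfolding fe_space_def by blast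
    then show ?thesis by (intro bexI[of _ "\<lambda>x. q x + r x"] polys_add) auto
  qed
  then show ?thesis using assms unfolding fe_space_def by (simp add: continuous_on_add)
qed

lemma fe_space_cmult:
  assumes "v \<in> fe_space p M"
  shows "(\<lambda>x. c * v x) \<in> fe_space p M"
proof -
  have "\<exists>q\<in>polys p. \<forall>x\<in>K. c * v (elem_map p M K x) = q x" if K: "K \<in> cells M" for K
  proof -
    obtain q where "q \<in> polys p" "\<forall>x\<in>K. v (elem_map p M K x) = q x"
      using assms K unfolding fe_space_def by blast
    then show ?thesis by (intro bexI[of _ "\<lambda>x. c * q x"] polys_cmult) auto
  qed
  then show ?thesis using assms unfolding fe_space_def by (simp add: continuous_on_mult_left)
qed

lemma vfe_space_add: "v \<in> vfe_space p M \<Longrightarrow> w \<in> vfe_space p M \<Longrightarrow> (\<lambda>x. v x + w x) \<in> vfe_space p M"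
  unfolding vfe_space_def by (simp add: fe_space_add)

lemma vfe_space_scaleR: "v \<in> vfe_space p M \<Longrightarrow> (\<lambda>x. c *\<^sub>R v x) \<in> vfe_space p M"
  unfolding vfe_space_def by (simp add: fe_space_cmult)

lemma vfe_space_diff:
  assumes "v \<in> vfe_space p M" "w \<in> vfe_space p M"
  shows "(\<lambda>x. v x - w x) \<in> vfe_space p M"
  using vfe_space_add[OF assms(1) vfe_space_scaleR[OF assms(2), of "-1"]] by simp

lemma vfe_space_sum:
  assumes "finite I" "I \<noteq> {}" "\<And>i. i \<in> I \<Longrightarrow> v i \<in> vfe_space p M"
  shows "(\<lambda>x. \<Sum>i\<in>I. v i x) \<in> vfe_space p M"
  using assms by (induction I rule: finite_ne_induct) (auto intro: vfe_space_add)

lemma vfe_space0_subset: "vfe_space0 p M \<subseteq> vfe_space p M"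
  unfolding vfe_space0_def vfe_space_def fe_space0_def by blast

lemma vfe_space0_uminus:
  assumes "v \<in> vfe_space0 p M"
  shows "(\<lambda>x. - v x) \<in> vfe_space0 p M"
proof -
  have "(\<lambda>x. - v x $ i) \<in> fe_space0 p M" for i
    using assms fe_space_cmult[of "\<lambda>x. v x $ i" p M "-1"]
    unfolding vfe_space0_def fe_space0_def by auto
  then show ?thesis unfolding vfe_space0_def by simp
qed

lemma fe_space_continuous: "v \<in> fe_space p M \<Longrightarrow> continuous_on (mesh_domain p M) v"
  unfolding fe_space_def by blast

lemma vfe_space_continuous: "v \<in> vfe_space p M \<Longrightarrow> continuous_on (mesh_domain p M) v"
  unfolding vfe_space_def using fe_space_continuous[of "\<lambda>x. v x $ _" p M]
  by (subst continuous_on_componentwise) (auto simp: Basis_vec_def inner_axis)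

context disk_triangulation
begin

text \<open>A finite element function is determined by its nodal values, because Lagrange interpolation
  reproduces its pull-back to each triangle.\<close>

lemma fe_eq_piecewise:
  assumes v: "v \<in> fe_space p M" and x: "x \<in> polygon"
  shows "v (isoparam x) = piecewise (\<lambda>a. v (node M a)) x"
proof -
  obtain K where K: "K \<in> cells M" "x \<in> K" using x by blast
  obtain q where q: "q \<in> polys p" "\<forall>x\<in>K. v (elem_map p M K x) = q x"
    using v K unfolding fe_space_def by blast
  have qv: "q y = v (isoparam y)" if "y \<in> K" for y
    using q(2) that isoparam_eq[OF K(1) that] by simp
  have "v (isoparam x) = lagrange p (vertices K) q x"
    using qv[OF K(2)] lagrange_reproduces[OF p cell_triangle(1)[OF K(1)] q(1)] by simp
  also have "\<dots> = lagrange p (vertices K) (\<lambda>a. v (node M a)) x"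
  proof (rule lagrange_cong)
    fix y assume "y \<in> lagrange_points p (vertices K)"
    then have y: "y \<in> ref_nodes p K" unfolding ref_nodes_eq .
    show "q y = v (node M y)"
      using qv[OF ref_nodes_in_cell[OF K(1) y]] isoparam_node[OF K(1) y] by simp
  qed
  finally show ?thesis using piecewise_eq[OF K] by metis
qed

lemma piecewise_nth: "piecewise f x $ i = piecewise (\<lambda>a. f a $ i) x"
  unfolding piecewise_def by (rule lagrange_nth)

lemma vfe_eq_piecewise:
  assumes v: "v \<in> vfe_space p M" and x: "x \<in> polygon"
  shows "v (isoparam x) = piecewise (\<lambda>a. v (node M a)) x"
proof -
  have "v (isoparam x) $ i = piecewise (\<lambda>a. v (node M a)) x $ i" for i
    using fe_eq_piecewise[of "\<lambda>x. v x $ i", OF _ x] v unfolding vfe_space_def piecewise_nth by simp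
  then show ?thesis by (simp add: vec_eq_iff)
qed

lemma quadratic_fe:
  assumes v: "v \<in> fe_space p M" and K: "K \<in> cells M"
  shows "\<exists>q. quadratic_on_lines q \<and> (\<forall>x\<in>K. v (isoparam x) = q x)"
proof -
  obtain q where q: "q \<in> polys p" "\<forall>x\<in>K. v (elem_map p M K x) = q x"
    using v K unfolding fe_space_def by blast
  then show ?thesis using isoparam_eq[OF K] polys_quadratic_on_lines[OF p] by auto
qed

lemma quadratic_vfe:
  assumes v: "v \<in> vfe_space p M" and K: "K \<in> cells M"
  shows "\<exists>q. quadratic_on_lines q \<and> (\<forall>x\<in>K. v (isoparam x) = q x)"
proof (intro exI conjI ballI)
  let ?q = "lagrange p (vertices K) (\<lambda>a. v (node M a))"
  show "quadratic_on_lines ?q"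
    by (rule quadratic_on_lines_vec)
      (simp add: lagrange_nth polys_quadratic_on_lines[OF p] lagrange_polys[OF p cell_triangle(1)[OF K]])
  show "v (isoparam x) = ?q x" if "x \<in> K" for x
    using vfe_eq_piecewise[OF v UnionI[OF K that]] unfolding piecewise_eq[OF K that] .
qed

text \<open>Nodal interpolation, carried out on the polygon and transported by the isoparametric map. It is
  0 off the mesh domain because finite element functions are represented by their extension by
  zero.\<close>

definition interpolant :: "(real^2 \<Rightarrow> 'a::real_vector) \<Rightarrow> real^2 \<Rightarrow> 'a" where
  "interpolant f y = (if y \<in> domain
     then piecewise (\<lambda>a. f (node M a)) (the_inv_into polygon isoparam y) else 0)"

lemma interpolant_iso: "x \<in> polygon \<Longrightarrow> interpolant f (isoparam x) = piecewise (\<lambda>a. f (node M a)) x"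
  unfolding interpolant_def using isoparam_image by (auto simp: the_inv_into_f_f[OF isoparam_inj_on])

lemma interpolant_nth: "interpolant f y $ i = interpolant (\<lambda>y. f y $ i) y"
  unfolding interpolant_def by (simp add: piecewise_nth)

lemma interpolant_node: "z \<in> nodes p M \<Longrightarrow> interpolant f z = f z"
proof -
  assume "z \<in> nodes p M"
  then obtain K a where K: "K \<in> cells M" "a \<in> ref_nodes p K" "z = node M a"
    unfolding nodes_def by blast
  have "a \<in> polygon" using K ref_nodes_in_cell by blast
  then show ?thesis using interpolant_iso[of a f] isoparam_node[OF K(1,2)] K piecewise_at_node[OF K(1,2)] by metis
qed

lemma interpolant_fe: "interpolant f \<in> fe_space p M"
proof -
  have "continuous_on domain (interpolant f)"
  proof -
    have inv: "continuous_on domain (the_inv_into polygon isoparam)"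
      using continuous_on_inv_into[OF isoparam_continuous_on polygon_compact isoparam_inj_on] unfolding isoparam_image .
    have "the_inv_into polygon isoparam ` domain \<subseteq> polygon"
      using the_inv_into_into[OF isoparam_inj_on] isoparam_image by blast
    then have "continuous_on domain (\<lambda>y. piecewise (\<lambda>a. f (node M a)) (the_inv_into polygon isoparam y))"
      using continuous_on_compose2[OF piecewise_continuous_on inv] by blast
    then show ?thesis unfolding interpolant_def by (simp cong: continuous_on_cong)
  qed
  moreover have "\<exists>q\<in>polys p. \<forall>x\<in>K. interpolant f (elem_map p M K x) = q x" if K: "K \<in> cells M" for K
  proof (intro bexI ballI)
    show "lagrange p (vertices K) (\<lambda>a. f (node M a)) \<in> polys p"
      by (rule lagrange_polys[OF p cell_triangle(1)[OF K]])
    show "interpolant f (elem_map p M K x) = lagrange p (vertices K) (\<lambda>a. f (node M a)) x" if "x \<in> K" for x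
    proof -
      have "x \<in> polygon" using K that by blast
      then show ?thesis
        unfolding isoparam_eq[OF K that, symmetric] piecewise_eq[OF K that, symmetric] by (rule interpolant_iso)
    qed
  qed
  ultimately show ?thesis unfolding fe_space_def by (simp add: interpolant_def)
qed

lemma interpolant_fe0:
  assumes "\<And>z. z \<in> nodes p M \<Longrightarrow> z \<in> frontier domain \<Longrightarrow> f z = 0"
  shows "interpolant f \<in> fe_space0 p M"
proof -
  have "interpolant f z = 0" if z: "z \<in> frontier domain" for z
  proof -
    have "closed domain" using domain_compact compact_imp_closed by blast
    then have "z \<in> domain" using z frontier_subset_closed by blast
    then obtain x where x: "x \<in> polygon" "z = isoparam x" using isoparam_image by blast
    have "piecewise (\<lambda>a. f (node M a)) x = 0"
    proof (rule piecewise_zero_on_frontier[OF x(1)])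
      show "x \<in> frontier polygon" using z x isoparam_frontier by simp
      fix K a assume a: "K \<in> cells M" "a \<in> ref_nodes p K" "a \<in> frontier polygon"
      have "a \<in> polygon" using ref_nodes_in_cell[OF a(1,2)] a(1) by blast
      then have "node M a \<in> frontier domain"
        using isoparam_frontier[of a] isoparam_node[OF a(1,2)] a(3) by simp
      moreover have "node M a \<in> nodes p M" using a unfolding nodes_def by blast
      ultimately show "f (node M a) = 0" using assms by blast
    qed
    then show ?thesis using interpolant_iso[OF x(1), of f] x(2) by simp
  qed
  then show ?thesis using interpolant_fe unfolding fe_space0_def by blast
qed

lemma interpolant_vfe: "interpolant f \<in> vfe_space p M"
  unfolding vfe_space_def by (simp add: interpolant_nth interpolant_fe)

lemma interpolant_vfe0:
  assumes "\<And>z. z \<in> nodes p M \<Longrightarrow> z \<in> frontier domain \<Longrightarrow> f z = 0"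
  shows "interpolant f \<in> vfe_space0 p M"
  unfolding vfe_space0_def using assms by (simp add: interpolant_nth interpolant_fe0)

text \<open>This makes the initial value of the scheme a finite element function: the interpolant exists and
  is unique.\<close>

lemma nodal_interp_vfe: "nodal_interp p M f \<in> vfe_space p M"
proof -
  have "nodal_interp p M f = interpolant f"
    unfolding nodal_interp_def
  proof (rule the_equality)
    show "interpolant f \<in> vfe_space p M \<and> (\<forall>z\<in>nodes p M. interpolant f z = f z)"
      using interpolant_vfe interpolant_node by blast
    fix v assume v: "v \<in> vfe_space p M \<and> (\<forall>z\<in>nodes p M. v z = f z)"
    show "v = interpolant f"
    proof
      fix y
      show "v y = interpolant f y"
      proof (cases "y \<in> domain")
        case True
        then obtain x where x: "x \<in> polygon" "y = isoparam x" using isoparam_image by blast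
        obtain K where K: "K \<in> cells M" "x \<in> K" using x by blast
        have "v y = lagrange p (vertices K) (\<lambda>a. v (node M a)) x"
          using vfe_eq_piecewise[of v x] v x piecewise_eq[OF K] by simp
        also have "\<dots> = lagrange p (vertices K) (\<lambda>a. f (node M a)) x"
        proof (rule lagrange_cong)
          fix a assume "a \<in> lagrange_points p (vertices K)"
          then have "node M a \<in> nodes p M" using K unfolding nodes_def ref_nodes_eq by blast
          then show "v (node M a) = f (node M a)" using v by blast
        qed
        also have "\<dots> = interpolant f y"
          unfolding x(2) interpolant_iso[OF x(1)] piecewise_eq[OF K] ..
        finally show ?thesis .
      next
        case False
        then have "v y $ i = 0" for i using v unfolding vfe_space_def fe_space_def by blast
        then show ?thesis using False by (simp add: interpolant_def vec_eq_iff)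
      qed
    qed
  qed
  then show ?thesis using interpolant_vfe by simp
qed

lemma diameter_le_mesh_size: "K \<in> cells M \<Longrightarrow> diameter K \<le> mesh_size M"
  unfolding mesh_size_def using finite_cells by simp

text \<open>On a fine mesh the corners of a triangle that contains the origin are interior, and their
  nodal basis functions belong to the homogeneous space.\<close>

lemma vfe_space0_nontrivial:
  assumes h: "mesh_size M < 1 / 2"
  shows "\<exists>v\<in>vfe_space0 p M. v \<noteq> (\<lambda>x. 0)"
proof -
  have "0 \<in> ball (0::real^2) (1 - mesh_size M)" using h by simp
  then obtain K where K: "K \<in> cells M" "0 \<in> K" using polygon_covers by blast
  have "vertices K \<noteq> {}" using K cell_triangle(2)[OF K(1)] by auto
  then obtain a where a: "a \<in> vertices K" by blast
  have aK: "a \<in> K" using a unfolding vertices_def extreme_point_of_def by blast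
  have "dist 0 a \<le> diameter K"
    using diameter_bounded_bound[OF compact_imp_bounded[OF cell_compact[OF K(1)]] K(2) aK] .
  then have "a \<in> ball 0 (1 - mesh_size M)" using diameter_le_mesh_size[OF K(1)] h by simp
  then have int: "a \<in> interior polygon" using polygon_covers by (meson interior_maximal open_ball subsetD)
  have node: "a \<in> ref_nodes p K" unfolding ref_nodes_eq using a by (rule lagrange_points_corner)
  have "node M a = a" using node_vertex K a by blast
  then have "a = isoparam a" "a \<in> nodes p M" using isoparam_node[OF K(1) node] node K unfolding nodes_def by force+
  have "a \<in> interior domain" using int \<open>a = isoparam a\<close> isoparam_interior by force
  then have off: "a \<notin> frontier domain" by (simp add: frontier_def)
  define f where "f y = (if y = a then axis 1 1 else 0 :: real^3)" for y
  have "interpolant f \<in> vfe_space0 p M"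
    by (rule interpolant_vfe0) (use off in \<open>auto simp: f_def\<close>)
  moreover have "interpolant f a \<noteq> 0"
    using interpolant_node[OF \<open>a \<in> nodes p M\<close>, of f] by (simp add: f_def)
  ultimately show ?thesis by (metis (mono_tags))
qed

text \<open>Each step adds a finite element function to a combination of earlier iterates. The membership
  supplies the measurability, and the elementwise polynomial structure, of the discrete solution.\<close>

lemma discrete_solution_vfe:
  assumes k: "k \<in> {1, 2}" and sol: "discrete_solution p k M \<tau> J u0 uh"
  shows "j \<le> J \<Longrightarrow> uh j \<in> vfe_space p M"
proof (induction j rule: less_induct)
  case (less j)
  have start: "uh 0 \<in> vfe_space p M"
    using sol nodal_interp_vfe unfolding discrete_solution_def by simp
  have first: "uh 1 \<in> vfe_space p M" if "k = 2"
    using sol that unfolding discrete_solution_def vfe_space_bd_def by simp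
  show ?case
  proof (cases "j < k")
    case True
    then show ?thesis using k start first by (cases j) auto
  next
    case False
    define i where "i = j - 1"
    have j: "j = i + 1" "i \<in> {k - 1..<J}" using False k less.prems by (auto simp: i_def)
    then have "bdf_step p k M \<tau> uh i" using sol unfolding discrete_solution_def by blast
    then obtain du where du: "du \<in> vfe_space p M" and eq:
      "uh (i + 1) = (\<lambda>x. (\<tau> / bdf k 0) *\<^sub>R du x - (\<Sum>l=1..k. (bdf k l / bdf k 0) *\<^sub>R uh (i + 1 - l) x))"
      using vfe_space0_subset unfolding bdf_step_def Let_def tangent_space_def by blast
    have "uh (i + 1 - l) \<in> vfe_space p M" if "l \<in> {1..k}" for l
      using less.IH[of "i + 1 - l"] less.prems j that by simp
    then have "(\<lambda>x. (\<tau> / bdf k 0) *\<^sub>R du x - (\<Sum>l=1..k. (bdf k l / bdf k 0) *\<^sub>R uh (i + 1 - l) x)) \<in> vfe_space p M"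
      using k by (intro vfe_space_diff vfe_space_scaleR vfe_space_sum du) auto
    then show ?thesis unfolding j(1) eq .
  qed
qed

end

section \<open>Estimates on a single element\<close>

text \<open>For \<open>y\<close> in the smaller ball, a fixed point of \<open>x - F x + y\<close> is a preimage of \<open>y\<close>.\<close>

lemma near_identity_covers_ball:
  fixes F :: "'a::euclidean_space \<Rightarrow> 'a"
  assumes cont: "continuous_on (cball a \<rho>) F" and "0 < \<rho>"
    and close: "\<And>x. x \<in> cball a \<rho> \<Longrightarrow> dist (F x) x \<le> \<delta>"
  shows "cball a (\<rho> - \<delta>) \<subseteq> F ` cball a \<rho>"
proof
  fix y assume y: "y \<in> cball a (\<rho> - \<delta>)"
  have "continuous_on (cball a \<rho>) (\<lambda>x. x - F x + y)"
    by (intro continuous_intros cont)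
  moreover have "(\<lambda>x. x - F x + y) \<in> cball a \<rho> \<rightarrow> cball a \<rho>"
  proof
    fix x assume "x \<in> cball a \<rho>"
    then have "norm (x - F x) \<le> \<delta>" using close by (simp add: dist_norm norm_minus_commute)
    moreover have "norm (a - y) \<le> \<rho> - \<delta>" using y by (simp add: dist_norm)
    moreover have "norm (a - (x - F x + y)) \<le> norm (a - y) + norm (x - F x)"
      using norm_triangle_ineq4[of "a - y" "x - F x"] by (simp add: algebra_simps)
    ultimately have "norm (a - (x - F x + y)) \<le> \<rho>" by linarith
    then show "x - F x + y \<in> cball a \<rho>" by (simp add: dist_norm)
  qed
  ultimately obtain x where "x \<in> cball a \<rho>" "x - F x + y = x"
    using brouwer_ball[OF \<open>0 < \<rho>\<close>] by blast
  then show "y \<in> F ` cball a \<rho>" by (auto simp: algebra_simps image_iff intro!: bexI[of _ x])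
qed

text \<open>A quadratic function is comparable to its maximum over \<open>K\<close> on a whole ball, centred at a
  maximum point over a small concentric ball: growth bounds the maximum over \<open>K\<close>, and
  the derivative bound keeps \<open>q\<close> large nearby. The constant \<open>A\<close> is the growth factor from radius \<open>r / 4\<close>
  to radius \<open>B r\<close>, and \<open>r / (12 A)\<close> is the distance over which \<open>q\<close> loses at most half of its value.\<close>

lemma quadratic_large_on_ball:
  fixes q :: "'a::euclidean_space \<Rightarrow> real"
  assumes q: "quadratic_on_lines q" and cont: "continuous_on K q"
    and K: "ball z r \<subseteq> K" "K \<subseteq> cball z (B * r)" and r: "0 < r" and B: "1 \<le> B"
  defines "A \<equiv> 64 * B\<^sup>2"
  obtains m a where "0 \<le> m" "\<And>x. x \<in> K \<Longrightarrow> \<bar>q x\<bar> \<le> m" "cball a (r / (12 * A)) \<subseteq> ball z r"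
    "\<And>x. x \<in> cball a (r / (12 * A)) \<Longrightarrow> m / (2 * A) \<le> \<bar>q x\<bar>"
proof -
  have A: "64 \<le> A" using B by (simp add: A_def)
  have small: "cball z (r / 4) \<subseteq> K" using K(1) r by (force simp: subset_iff)
  have "continuous_on (cball z (r / 4)) (\<lambda>x. \<bar>q x\<bar>)"
    using continuous_on_subset[OF cont small] by (intro continuous_intros)
  then obtain a where a: "a \<in> cball z (r / 4)" "\<And>x. x \<in> cball z (r / 4) \<Longrightarrow> \<bar>q x\<bar> \<le> \<bar>q a\<bar>"
    using continuous_attains_sup[OF compact_cball, of z "r / 4" "\<lambda>x. \<bar>q x\<bar>"] r by auto
  define m where "m = A * \<bar>q a\<bar>"
  have bound: "\<bar>q x\<bar> \<le> m" if "x \<in> K" for x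
  proof -
    have "norm (q x) \<le> 4 * (B * r / (r / 4))\<^sup>2 * \<bar>q a\<bar>"
    proof (rule quadratic_growth[OF q])
      have "1 * r \<le> B * r" using B r by (intro mult_right_mono) auto
      then show "r / 4 \<le> B * r" using r by simp
    qed (use r a that K in auto)
    also have "4 * (B * r / (r / 4))\<^sup>2 = A" using r by (simp add: A_def power_mult_distrib)
    finally show ?thesis by (simp add: m_def)
  qed
  have rho: "r / (12 * A) \<le> r / 2" using A r by (intro divide_left_mono) auto
  have sub: "cball a (r / 2) \<subseteq> ball z r"
  proof
    fix x assume "x \<in> cball a (r / 2)"
    then show "x \<in> ball z r" using a(1) dist_triangle[of z x a] r by simp
  qed
  have "m / (2 * A) \<le> \<bar>q x\<bar>" if x: "x \<in> cball a (r / (12 * A))" for x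
  proof -
    have m0: "0 \<le> m" using A by (simp add: m_def)
    have "norm (q x - q a) \<le> 3 * (norm (x - a) / (r / 2)) * m"
    proof (rule quadratic_lipschitz[OF q])
      show "norm (q x) \<le> m" if "x \<in> cball a (r / 2)" for x
        using bound[OF subsetD[OF K(1) subsetD[OF sub that]]] by simp
    qed (use r x rho in auto)
    also have "\<dots> \<le> 3 * (r / (12 * A) / (r / 2)) * m"
      using x r m0 by (intro mult_right_mono mult_left_mono divide_right_mono)
        (auto simp: dist_norm norm_minus_commute)
    also have "\<dots> = \<bar>q a\<bar> / 2" using r A by (simp add: m_def)
    finally have "\<bar>q a\<bar> / 2 \<le> \<bar>q x\<bar>" by (simp add: abs_real_def split: if_splits)
    then show ?thesis using A by (simp add: m_def)
  qed
  moreover have "cball a (r / (12 * A)) \<subseteq> ball z r"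
    using sub rho subset_cball[OF rho, of a] by blast
  moreover have "0 \<le> m" using A by (simp add: m_def)
  ultimately show thesis using that bound by blast
qed

lemma set_integral_ge_on_subset:
  fixes f :: "'a \<Rightarrow> real"
  assumes f: "set_integrable N S f" "\<And>x. x \<in> S \<Longrightarrow> 0 \<le> f x"
    and U: "U \<subseteq> S" "U \<in> sets N" "emeasure N U < \<infinity>" "\<And>x. x \<in> U \<Longrightarrow> c \<le> f x"
  shows "c * measure N U \<le> (LINT x:S|N. f x)"
proof -
  have "c * measure N U = (LINT x|N. indicator U x * c)"
    using U by (simp add: measure_def)
  also have "\<dots> \<le> (LINT x|N. indicator S x * f x)"
  proof (rule integral_mono)
    show "integrable N (\<lambda>x. indicator U x * c)" using U by (intro integrable_mult_left) auto
    show "integrable N (\<lambda>x. indicator S x * f x)" using f(1) by (simp add: set_integrable_def)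
    show "indicator U x * c \<le> indicator S x * f x" for x
      using U f(2) by (auto simp: indicator_def)
  qed
  finally show ?thesis by (simp add: set_lebesgue_integral_def)
qed

context disk_triangulation
begin

text \<open>Interpolation reproduces the identity, so the displacement is the interpolant of the nodal
  displacements.\<close>

lemma isoparam_displacement:
  assumes K: "K \<in> cells M" "x \<in> K" and \<delta>: "\<And>a. a \<in> ref_nodes p K \<Longrightarrow> dist (node M a) a \<le> \<delta>"
  shows "dist (isoparam x) x \<le> 3 * \<delta>"
proof -
  note V = cell_triangle[OF K(1)]
  have coord: "(\<lambda>x::real^2. x $ i) \<in> polys p" for i
  proof -
    have "(\<lambda>x::real^2. x $ i) \<in> polys 1"
      using linear_polys_1[of "\<lambda>x. x $ i" 0] by (simp add: linear_iff)
    then show ?thesis using p polys_1_subset_2 by auto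
  qed
  have "lagrange p (vertices K) (\<lambda>y. y) x = x"
    by (simp add: vec_eq_iff lagrange_nth lagrange_reproduces[OF p V(1) coord])
  then have "isoparam x - x = lagrange p (vertices K) (\<lambda>a. node M a - a) x"
    by (simp add: lagrange_diff isoparam_def piecewise_eq[OF K])
  also have "norm \<dots> \<le> 3 * \<delta>"
    using \<delta> K V by (intro lagrange_bound) (auto simp: ref_nodes_eq dist_norm)
  finally show ?thesis by (simp add: dist_norm)
qed

lemma continuous_set_integrable:
  fixes f :: "real^2 \<Rightarrow> 'a::{banach, second_countable_topology}"
  assumes "continuous_on domain f"
  shows "set_integrable lebesgue domain f"
proof -
  have "integrable lborel (\<lambda>x. indicator domain x *\<^sub>R f x)"
    by (rule borel_integrable_compact[OF domain_compact assms])
  then show ?thesis unfolding set_integrable_def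
    by (simp add: integrable_completion)
qed

lemma isoparam_cell_measurable:
  assumes "K \<in> cells M"
  shows "compact (isoparam ` K)" "open (isoparam ` interior K)" "isoparam ` K \<subseteq> domain"
proof -
  have sub: "K \<subseteq> polygon" using assms by blast
  show "compact (isoparam ` K)"
    using compact_continuous_image continuous_on_subset[OF isoparam_continuous_on sub] cell_compact assms by blast
  show "open (isoparam ` interior K)"
    using isoparam_open_image[OF open_interior] sub interior_subset by blast
  show "isoparam ` K \<subseteq> domain" using sub isoparam_image by blast
qed

text \<open>An inverse estimate from the maximum to the \<open>L\<^sup>2\<close> norm. The displacement bound replaces the change of
  variables: the image of the ball of radius \<open>\<rho>\<close> on which \<open>w\<close> is large still contains a ball of half the
  radius, while the whole image of \<open>K\<close> lies in a ball of radius \<open>2 B r\<close>. With \<open>A = 64 B\<^sup>2\<close> the constant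
  \<open>96 A\<^sup>2 B = 393216 B\<^sup>5\<close> is the ratio \<open>4 B r / \<rho>\<close> of the two radii times the loss \<open>2 A\<close> in the value of
  \<open>w\<close>.\<close>

lemma element_max_le_l2:
  assumes w: "w \<in> fe_space p M" and K: "K \<in> cells M"
    and z: "ball z r \<subseteq> K" "K \<subseteq> cball z (B * r)" and r: "0 < r" and B: "1 \<le> B"
    and \<delta>: "\<And>x. x \<in> K \<Longrightarrow> dist (isoparam x) x \<le> r / (1536 * B\<^sup>2)"
  shows "\<exists>m\<ge>0. (\<forall>x\<in>K. \<bar>w (isoparam x)\<bar> \<le> m) \<and>
    m\<^sup>2 * measure lebesgue (isoparam ` K) \<le> (393216 * B ^ 5)\<^sup>2 * (LINT y:isoparam ` interior K|lebesgue. (w y)\<^sup>2)"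
proof -
  define A where "A = 64 * B\<^sup>2"
  define \<rho> where "\<rho> = r / (12 * A)"
  have "1 \<le> B\<^sup>2" using B by simp
  then have A: "64 \<le> A" by (simp add: A_def)
  have \<rho>: "0 < \<rho>" using A r by (simp add: \<rho>_def)
  have half: "r / (1536 * B\<^sup>2) = \<rho> / 2" by (simp add: \<rho>_def A_def)
  obtain q where q: "quadratic_on_lines q" "\<forall>x\<in>K. w (isoparam x) = q x"
    using quadratic_fe[OF w K] by blast
  have sub: "K \<subseteq> polygon" using K by blast
  have cont: "continuous_on K isoparam" by (rule continuous_on_subset[OF isoparam_continuous_on sub])
  have "continuous_on K (\<lambda>x. w (isoparam x))"
    using continuous_on_compose2[OF fe_space_continuous[OF w] cont] isoparam_cell_measurable(3)[OF K] by blast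
  then have "continuous_on K q" using q(2) by (simp cong: continuous_on_cong)
  then obtain m a where m: "0 \<le> m" "\<And>x. x \<in> K \<Longrightarrow> \<bar>q x\<bar> \<le> m"
    and a: "cball a \<rho> \<subseteq> ball z r" "\<And>x. x \<in> cball a \<rho> \<Longrightarrow> m / (2 * A) \<le> \<bar>q x\<bar>"
    using quadratic_large_on_ball[OF q(1) _ z r B] unfolding \<rho>_def A_def by blast
  have int: "cball a \<rho> \<subseteq> interior K" using a(1) z(1) by (meson interior_maximal open_ball order_trans)
  have "cball a (\<rho> - \<rho> / 2) \<subseteq> isoparam ` cball a \<rho>"
  proof (rule near_identity_covers_ball[OF _ \<rho>])
    show "continuous_on (cball a \<rho>) isoparam"
      using continuous_on_subset[OF cont] int interior_subset by blast
    show "dist (isoparam x) x \<le> \<rho> / 2" if "x \<in> cball a \<rho>" for x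
      using \<delta>[of x] that int interior_subset half by fastforce
  qed
  then have cover: "cball a (\<rho> / 2) \<subseteq> isoparam ` cball a \<rho>" by simp
  then have cover_int: "cball a (\<rho> / 2) \<subseteq> isoparam ` interior K" using int by blast
  have large: "(m / (2 * A))\<^sup>2 \<le> (w y)\<^sup>2" if y: "y \<in> cball a (\<rho> / 2)" for y
  proof -
    obtain x where x: "x \<in> cball a \<rho>" "y = isoparam x" using y cover by blast
    then have "m / (2 * A) \<le> \<bar>w y\<bar>" using a(2) q(2) int interior_subset by fastforce
    then show ?thesis using m(1) A by (metis abs_ge_zero abs_le_square_iff abs_of_nonneg divide_nonneg_nonneg
          mult_nonneg_nonneg order_trans zero_le_numeral power2_abs power_mono)
  qed
  have "continuous_on domain (\<lambda>y. (w y)\<^sup>2)"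
    by (intro continuous_intros fe_space_continuous[OF w])
  then have "set_integrable lebesgue (isoparam ` interior K) (\<lambda>y. (w y)\<^sup>2)"
    using set_integrable_subset[OF continuous_set_integrable] isoparam_cell_measurable[OF K]
      interior_subset[of K] by (meson image_mono order_trans borel_open sets_completionI_sets sets_lborel lborelD)
  then have lower: "(m / (2 * A))\<^sup>2 * measure lebesgue (cball a (\<rho> / 2))
      \<le> (LINT y:isoparam ` interior K|lebesgue. (w y)\<^sup>2)"
    using large cover_int
    by (intro set_integral_ge_on_subset) (use emeasure_lborel_cball_finite[of a "\<rho> / 2"] in auto)
  have "isoparam ` K \<subseteq> cball z (2 * B * r)"
  proof
    fix y assume "y \<in> isoparam ` K"
    then obtain x where x: "x \<in> K" "y = isoparam x" by blast
    have "dist (isoparam x) x \<le> \<rho> / 2" using \<delta>[OF x(1)] half by simp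
    also have "\<rho> / 2 \<le> r" using A r by (simp add: \<rho>_def field_simps)
    also have "r \<le> B * r" using B r by simp
    finally have "dist x y \<le> B * r" using x by (simp add: dist_commute)
    moreover have "dist z x \<le> B * r" using x z(2) by auto
    ultimately show "y \<in> cball z (2 * B * r)" using dist_triangle[of z y x] by simp
  qed
  then have "measure lebesgue (isoparam ` K) \<le> measure lebesgue (cball z (2 * B * r))"
    using isoparam_cell_measurable(1)[OF K]
    by (intro measure_mono_fmeasurable) (auto simp: lmeasurable_compact fmeasurableD)
  also have "\<dots> = (48 * A * B)\<^sup>2 * measure lebesgue (cball a (\<rho> / 2))"
  proof -
    have vol: "measure lebesgue (cball c s) = unit_ball_vol 2 * s\<^sup>2" if "0 \<le> s" for c :: "real^2" and s
      using content_cball[OF that, of c] by simp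
    have "2 * B * r = 48 * A * B * (\<rho> / 2)" using A by (simp add: \<rho>_def)
    then have "(2 * B * r)\<^sup>2 = (48 * A * B)\<^sup>2 * (\<rho> / 2)\<^sup>2"
      by (simp only: power_mult_distrib)
    moreover have "0 \<le> 2 * B * r" "0 \<le> \<rho> / 2" using B r \<rho> by auto
    ultimately show ?thesis by (simp only: vol mult.left_commute)
  qed
  finally have "m\<^sup>2 * measure lebesgue (isoparam ` K)
      \<le> m\<^sup>2 * ((48 * A * B)\<^sup>2 * measure lebesgue (cball a (\<rho> / 2)))"
    by (intro mult_left_mono) auto
  also have "\<dots> = (96 * A\<^sup>2 * B)\<^sup>2 * ((m / (2 * A))\<^sup>2 * measure lebesgue (cball a (\<rho> / 2)))"
    using A by (simp add: power_mult_distrib power_divide power2_eq_square)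
  also have "\<dots> \<le> (96 * A\<^sup>2 * B)\<^sup>2 * (LINT y:isoparam ` interior K|lebesgue. (w y)\<^sup>2)"
    using lower by (intro mult_left_mono) auto
  also have "96 * A\<^sup>2 * B = 393216 * B ^ 5"
    by (simp add: A_def power2_eq_square eval_nat_numeral)
  finally show ?thesis using m q(2) by auto
qed

text \<open>On the small ball the image under the isoparametric map stays inside the disk, which need not be
  the case near the boundary of \<open>K\<close>; polynomial growth bridges the gap.\<close>

lemma element_close_from_ball:
  assumes v: "v \<in> vfe_space p M" and K: "K \<in> cells M"
    and z: "ball z r \<subseteq> K" "K \<subseteq> cball z (B * r)" and r: "0 < r" and B: "1 \<le> B"
    and close: "\<And>x. x \<in> cball z (r / 4) \<Longrightarrow> norm (v (isoparam x) - c) \<le> \<eta>" and x: "x \<in> K"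
  shows "norm (v (isoparam x) - c) \<le> 64 * B\<^sup>2 * \<eta>"
proof -
  obtain q where q: "quadratic_on_lines q" "\<forall>x\<in>K. v (isoparam x) = q x"
    using quadratic_vfe[OF v K] by blast
  have small: "cball z (r / 4) \<subseteq> K" using z(1) r by (force simp: subset_iff)
  have "norm (q x - c) \<le> 4 * (B * r / (r / 4))\<^sup>2 * \<eta>"
  proof (rule quadratic_growth[OF quadratic_on_lines_diff_const[OF q(1)]])
    have "1 * r \<le> B * r" using B r by (intro mult_right_mono) auto
    then show "r / 4 \<le> B * r" using r by simp
    show "norm (q y - c) \<le> \<eta>" if "y \<in> cball z (r / 4)" for y
      using close[OF that] q(2) that small by force
  qed (use r x z in auto)
  then show ?thesis using q(2) x r by (simp add: power_mult_distrib)
qed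

text \<open>Both functions are continuous on this open set, and an open null set is empty. An infinite
  essential supremum, which is also the value for non-measurable functions, is excluded by the
  assumption.\<close>

lemma linf_norm_pointwise:
  assumes v: "v \<in> vfe_space p M" and g: "continuous_on (cball 0 1) g"
    and le: "linf_norm (ball 0 1 \<inter> domain) (\<lambda>x. v x - g x) \<le> ereal \<epsilon>"
    and y: "y \<in> ball 0 1 \<inter> interior domain"
  shows "norm (v y - g y) \<le> \<epsilon>"
proof (rule ccontr)
  assume "\<not> norm (v y - g y) \<le> \<epsilon>"
  define S where "S = ball (0::real^2) 1 \<inter> domain"
  define U where "U = {x \<in> ball 0 1 \<inter> interior domain. \<epsilon> < norm (v x - g x)}"
  have "continuous_on (ball 0 1 \<inter> interior domain) (\<lambda>x. norm (v x - g x))"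
    using interior_subset
    by (intro continuous_intros continuous_on_subset[OF vfe_space_continuous[OF v]]
        continuous_on_subset[OF g]) auto
  then have "open ((ball 0 1 \<inter> interior domain) \<inter> (\<lambda>x. norm (v x - g x)) -` {\<epsilon><..})"
    by (intro continuous_open_preimage open_Int) auto
  also have "(ball 0 1 \<inter> interior domain) \<inter> (\<lambda>x. norm (v x - g x)) -` {\<epsilon><..} = U"
    unfolding U_def by auto
  finally have "open U" .
  have "S \<in> sets lebesgue"
    using lmeasurable_compact[OF domain_compact] unfolding S_def by (intro sets.Int fmeasurableD) auto
  have "AE x in lebesgue_on S. ereal (norm (v x - g x)) \<le> esssup (lebesgue_on S) (\<lambda>x. ereal (norm (v x - g x)))"
    by (rule esssup_AE)
  then have "AE x in lebesgue_on S. norm (v x - g x) \<le> \<epsilon>"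
    using le unfolding linf_norm_def S_def[symmetric]
    by (auto elim!: eventually_mono simp flip: ereal_less_eq(3) intro: order_trans)
  then have "AE x in lebesgue. x \<in> S \<longrightarrow> norm (v x - g x) \<le> \<epsilon>"
    using \<open>S \<in> sets lebesgue\<close> by (simp add: AE_restrict_space_iff)
  then obtain N where N: "{x \<in> space lebesgue. \<not> (x \<in> S \<longrightarrow> norm (v x - g x) \<le> \<epsilon>)} \<subseteq> N"
    "N \<in> null_sets lebesgue" unfolding eventually_ae_filter by blast
  have "U \<subseteq> N" using N(1) interior_subset unfolding U_def S_def by fastforce
  then have "negligible U" using N(2) negligible_iff_null_sets negligible_subset by blast
  moreover have "y \<in> U" using y \<open>\<not> norm (v y - g y) \<le> \<epsilon>\<close> unfolding U_def by simp
  ultimately show False using open_not_negligible[OF \<open>open U\<close>] by blast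
qed

end

section \<open>The inf-sup condition\<close>

lemma sum_set_integral_le_disjoint:
  fixes f :: "'a \<Rightarrow> real"
  assumes "finite I" "disjoint_family_on A I" "\<And>i. i \<in> I \<Longrightarrow> A i \<in> sets N" "\<And>i. i \<in> I \<Longrightarrow> A i \<subseteq> S"
    and f: "set_integrable N S f" "\<And>x. x \<in> S \<Longrightarrow> 0 \<le> f x"
  shows "(\<Sum>i\<in>I. LINT x:A i|N. f x) \<le> (LINT x:S|N. f x)"
proof -
  have sub: "(\<Union>i\<in>I. A i) \<subseteq> S" "(\<Union>i\<in>I. A i) \<in> sets N" using assms by auto
  have int: "set_integrable N (A i) f" if "i \<in> I" for i
    using set_integrable_subset[OF f(1)] assms(3,4) that by blast
  have "(\<Sum>i\<in>I. LINT x:A i|N. f x) = (LINT x:(\<Union>i\<in>I. A i)|N. f x)"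
    using set_integral_finite_Union[OF assms(1,2) int assms(3)] by simp
  also have "\<dots> \<le> (LINT x:S|N. f x)"
    unfolding set_lebesgue_integral_def
  proof (rule integral_mono)
    show "integrable N (\<lambda>x. indicat_real (\<Union>i\<in>I. A i) x *\<^sub>R f x)"
      using set_integrable_subset[OF f(1) sub(2,1)] by (simp add: set_integrable_def)
    show "integrable N (\<lambda>x. indicat_real S x *\<^sub>R f x)" using f(1) by (simp add: set_integrable_def)
    show "indicat_real (\<Union>i\<in>I. A i) x *\<^sub>R f x \<le> indicat_real S x *\<^sub>R f x" for x
      using sub(1) f(2) by (auto simp: indicator_def)
  qed
  finally show ?thesis .
qed

text \<open>The numbers: \<open>y \<bullet> c \<ge> 6/7\<close> and \<open>norm y \<le> 8/7\<close>.\<close>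

lemma normalized_inner_ge:
  fixes c y :: "'a::real_inner"
  assumes "norm c = 1" "norm (y - c) \<le> 1 / 7"
  shows "3 / 4 \<le> (y /\<^sub>R norm y) \<bullet> c"
proof -
  have "\<bar>(y - c) \<bullet> c\<bar> \<le> 1 / 7" using Cauchy_Schwarz_ineq2[of "y - c" c] assms by simp
  moreover have "y \<bullet> c = 1 + (y - c) \<bullet> c"
    using assms(1) by (simp add: inner_diff_left dot_square_norm)
  ultimately have yc: "6 / 7 \<le> y \<bullet> c" by linarith
  have ny: "norm y \<le> 8 / 7" using norm_triangle_sub[of y c] assms by simp
  have "0 < norm y" using yc by auto
  have "3 / 4 * norm y \<le> y \<bullet> c" using yc ny by linarith
  then show ?thesis using \<open>0 < norm y\<close> by (simp add: field_simps)
qed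

context disk_triangulation
begin

lemma vfe_borel:
  assumes "v \<in> vfe_space p M"
  shows "v \<in> borel_measurable borel"
proof -
  have "(\<lambda>x. indicator domain x *\<^sub>R v x) \<in> borel_measurable borel"
    using borel_measurable_continuous_on_indicator[OF _ vfe_space_continuous[OF assms]] domain_compact
    by (simp add: borel_compact)
  moreover have "indicator domain x *\<^sub>R v x = v x" for x
  proof (cases "x \<in> domain")
    case False
    then have "v x $ i = 0" for i using assms unfolding vfe_space_def fe_space_def by blast
    then show ?thesis by (simp add: vec_eq_iff)
  qed simp
  ultimately show ?thesis by simp
qed

lemma fe_borel:
  assumes "w \<in> fe_space p M"
  shows "w \<in> borel_measurable borel"
proof -
  have "(\<lambda>x. indicator domain x *\<^sub>R w x) \<in> borel_measurable borel"
    using borel_measurable_continuous_on_indicator[OF _ fe_space_continuous[OF assms]] domain_compact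
    by (simp add: borel_compact)
  moreover have "(\<lambda>x. indicator domain x *\<^sub>R w x) = w"
    using assms unfolding fe_space_def by (auto simp: indicator_def fun_eq_iff)
  ultimately show ?thesis by (simp only:)
qed

text \<open>The field \<open>b\<close> is merely measurable: a field obtained by normalization may jump at zeros of the original
  one.\<close>

lemma bform_integrable:
  fixes b :: "real^2 \<Rightarrow> real^3"
  assumes b: "b \<in> borel_measurable borel" "\<And>y. norm (b y) \<le> 1"
    and v: "v \<in> vfe_space p M" and w: "w \<in> fe_space p M"
  shows "set_integrable lebesgue domain (\<lambda>y. (b y \<bullet> v y) * w y)"
proof (rule set_integrable_bound)
  show "set_integrable lebesgue domain (\<lambda>y. norm (v y) * \<bar>w y\<bar>)"
    by (rule continuous_set_integrable)
      (intro continuous_intros vfe_space_continuous[OF v] fe_space_continuous[OF w])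
  have "(\<lambda>y. indicator domain y *\<^sub>R ((b y \<bullet> v y) * w y)) \<in> borel_measurable borel"
    using b(1) vfe_borel[OF v] fe_borel[OF w] domain_compact
    by (intro borel_measurable_scaleR borel_measurable_indicator borel_measurable_times
        borel_measurable_inner) (auto simp: borel_compact)
  then show "set_borel_measurable lebesgue domain (\<lambda>y. (b y \<bullet> v y) * w y)"
    unfolding set_borel_measurable_def by (simp add: measurable_completion)
  have "norm ((b y \<bullet> v y) * w y) \<le> norm (norm (v y) * \<bar>w y\<bar>)" for y
  proof -
    have "\<bar>b y \<bullet> v y\<bar> \<le> norm (b y) * norm (v y)" by (rule Cauchy_Schwarz_ineq2)
    also have "\<dots> \<le> 1 * norm (v y)" using b(2) by (intro mult_right_mono) auto
    finally show ?thesis by (simp add: abs_mult mult_right_mono)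
  qed
  then show "AE y in lebesgue. y \<in> domain \<longrightarrow> norm ((b y \<bullet> v y) * w y) \<le> norm (norm (v y) * \<bar>w y\<bar>)"
    by simp
qed

lemma l2_norm_power2:
  fixes f :: "real^2 \<Rightarrow> 'a::real_inner"
  shows "(l2_norm S f)\<^sup>2 = (LINT x:S|lebesgue. f x \<bullet> f x)" "0 \<le> l2_norm S f"
proof -
  have "0 \<le> (LINT x:S|lebesgue. f x \<bullet> f x)"
    unfolding set_lebesgue_integral_def by (intro Bochner_Integration.integral_nonneg) auto
  then show "(l2_norm S f)\<^sup>2 = (LINT x:S|lebesgue. f x \<bullet> f x)" "0 \<le> l2_norm S f"
    unfolding l2_norm_def l2_inner_def by simp_all
qed

text \<open>As \<open>c\<close> is constant, \<open>w c\<close> is its own interpolant on the element.\<close>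

lemma interpolant_product_error:
  fixes g :: "real^2 \<Rightarrow> 'a::real_normed_vector"
  assumes w: "w \<in> fe_space p M" and K: "K \<in> cells M" "x \<in> K"
    and g: "\<And>a. a \<in> ref_nodes p K \<Longrightarrow> norm (g (node M a) - c) \<le> \<theta>"
    and m: "\<And>x. x \<in> K \<Longrightarrow> \<bar>w (isoparam x)\<bar> \<le> m"
  shows "norm (interpolant (\<lambda>z. w z *\<^sub>R g z) (isoparam x) - w (isoparam x) *\<^sub>R c) \<le> 3 * (m * \<theta>)"
proof -
  note V = cell_triangle[OF K(1)]
  have x: "x \<in> polygon" using K by blast
  have "interpolant (\<lambda>z. w z *\<^sub>R g z) (isoparam x) - w (isoparam x) *\<^sub>R c
      = lagrange p (vertices K) (\<lambda>a. w (node M a) *\<^sub>R g (node M a)) x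
        - lagrange p (vertices K) (\<lambda>a. w (node M a)) x *\<^sub>R c"
    unfolding interpolant_iso[OF x] fe_eq_piecewise[OF w x] piecewise_eq[OF K] ..
  also have "\<dots> = lagrange p (vertices K) (\<lambda>a. w (node M a) *\<^sub>R (g (node M a) - c)) x"
    by (simp add: lagrange_diff lagrange_scaleR_const[symmetric] scaleR_diff_right)
  also have "norm \<dots> \<le> 3 * (m * \<theta>)"
  proof (rule lagrange_bound[OF V(1)])
    show "x \<in> convex hull vertices K" using V(2) K(2) by blast
    fix a assume "a \<in> lagrange_points p (vertices K)"
    then have a: "a \<in> ref_nodes p K" unfolding ref_nodes_eq .
    have wa: "\<bar>w (node M a)\<bar> \<le> m"
      using m[OF ref_nodes_in_cell[OF K(1) a]] isoparam_node[OF K(1) a] by simp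
    have "\<bar>w (node M a)\<bar> * norm (g (node M a) - c) \<le> m * \<theta>"
      using wa g[OF a] by (intro mult_mono) auto
    then show "norm (w (node M a) *\<^sub>R (g (node M a) - c)) \<le> m * \<theta>" by simp
  qed
  finally show ?thesis .
qed

text \<open>On an element the deviation of \<open>v\<close> from \<open>w c\<close> is at most \<open>3 \<theta>\<close> times the maximum of \<open>w\<close> there, and the squares of these maxima, weighted by the areas of
  the elements, sum up to at most \<open>C\<close> times the squared \<open>L\<^sup>2\<close> norm of \<open>w\<close>. Thus for small \<open>\<theta>\<close> the
  deviation is absorbed by the main term \<open>w\<^sup>2 (b \<bullet> c)\<close>.\<close>

lemma interpolant_product_coercive:
  fixes b g :: "real^2 \<Rightarrow> real^3" and c :: "(real^2) set \<Rightarrow> real^3" and m :: "(real^2) set \<Rightarrow> real"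
  assumes w: "w \<in> fe_space p M"
    and b: "b \<in> borel_measurable borel" "\<And>y. norm (b y) \<le> 1"
    and c: "\<And>K. K \<in> cells M \<Longrightarrow> norm (c K) = 1"
      "\<And>K x. K \<in> cells M \<Longrightarrow> x \<in> K \<Longrightarrow> 3 / 4 \<le> b (isoparam x) \<bullet> c K"
    and g: "\<And>K a. K \<in> cells M \<Longrightarrow> a \<in> ref_nodes p K \<Longrightarrow> norm (g (node M a) - c K) \<le> \<theta>"
    and m: "\<And>K x. K \<in> cells M \<Longrightarrow> x \<in> K \<Longrightarrow> \<bar>w (isoparam x)\<bar> \<le> m K"
      "\<And>K. K \<in> cells M \<Longrightarrow> (m K)\<^sup>2 * measure lebesgue (isoparam ` K)
        \<le> C * (LINT y:isoparam ` interior K|lebesgue. (w y)\<^sup>2)"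
    and \<theta>: "0 \<le> \<theta>" "9 * \<theta>\<^sup>2 * C \<le> 1 / 4" "0 \<le> C"
  defines "v \<equiv> interpolant (\<lambda>z. w z *\<^sub>R g z)"
  shows "(l2_norm domain w)\<^sup>2 / 4 \<le> bform p M b v w"
    and "l2_norm domain v \<le> 2 * l2_norm domain w"
proof -
  define W where "W = (LINT y:domain|lebesgue. (w y)\<^sup>2)"
  have W: "(l2_norm domain w)\<^sup>2 = W" unfolding l2_norm_power2(1) W_def by (simp add: power2_eq_square)
  have vfe: "v \<in> vfe_space p M" unfolding v_def by (rule interpolant_vfe)
  have int_w: "set_integrable lebesgue domain (\<lambda>y. (w y)\<^sup>2)"
    by (rule continuous_set_integrable) (intro continuous_intros fe_space_continuous[OF w])
  have int_v: "set_integrable lebesgue domain (\<lambda>y. v y \<bullet> v y)"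
    by (rule continuous_set_integrable) (intro continuous_intros vfe_space_continuous[OF vfe])
  \<comment> \<open>a step function that dominates the squared elementwise maxima; where images of elements meet,
    the contributions add up, which is harmless for an upper bound\<close>
  define N where "N y = (\<Sum>K\<in>cells M. (m K)\<^sup>2 * indicator (isoparam ` K) y)" for y
  have meas: "isoparam ` K \<in> lmeasurable" if "K \<in> cells M" for K
    using isoparam_cell_measurable(1)[OF that] by (rule lmeasurable_compact)
  have dom: "domain \<in> sets lebesgue" using lmeasurable_compact[OF domain_compact] by blast
  have int_N: "set_integrable lebesgue domain N"
  proof -
    have "integrable lebesgue N"
      unfolding N_def using meas by (intro Bochner_Integration.integrable_sum integrable_mult_right)
        (auto simp: lmeasurable_iff_integrable)
    then show ?thesis unfolding set_integrable_def by (rule integrable_mult_indicator[OF dom])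
  qed
  have N_le: "(LINT y:domain|lebesgue. N y) \<le> C * W"
  proof -
    have "(LINT y:domain|lebesgue. N y) = (LINT y|lebesgue. N y)"
      unfolding set_lebesgue_integral_def
    proof (rule Bochner_Integration.integral_cong[OF refl])
      have "N y = 0" if "y \<notin> domain" for y
        unfolding N_def using isoparam_cell_measurable(3) that by (intro sum.neutral) (auto simp: indicator_def)
      then show "indicator domain y *\<^sub>R N y = N y" for y by (auto simp: indicator_def)
    qed
    also have "\<dots> = (\<Sum>K\<in>cells M. (m K)\<^sup>2 * measure lebesgue (isoparam ` K))"
      unfolding N_def using meas
      by (subst Bochner_Integration.integral_sum) (auto simp: lmeasurable_iff_integrable)
    also have "\<dots> \<le> (\<Sum>K\<in>cells M. C * (LINT y:isoparam ` interior K|lebesgue. (w y)\<^sup>2))"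
      using m(2) by (intro sum_mono) auto
    also have "\<dots> = C * (\<Sum>K\<in>cells M. LINT y:isoparam ` interior K|lebesgue. (w y)\<^sup>2)"
      by (simp add: sum_distrib_left)
    also have "\<dots> \<le> C * W"
      unfolding W_def
    proof (intro mult_left_mono sum_set_integral_le_disjoint finite_cells int_w \<theta>)
      \<comment> \<open>with interiors the images are truly disjoint, and no null sets have to be discussed\<close>
      show "disjoint_family_on (\<lambda>K. isoparam ` interior K) (cells M)"
        unfolding disjoint_family_on_def
      proof (intro ballI impI, rule ccontr)
        fix K L assume KL: "K \<in> cells M" "L \<in> cells M" "K \<noteq> L" "isoparam ` interior K \<inter> isoparam ` interior L \<noteq> {}"
        then obtain x y where xy: "x \<in> interior K" "y \<in> interior L" "isoparam x = isoparam y" by blast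
        then have "x = y" using inj_onD[OF isoparam_inj_on xy(3)] KL(1,2) interior_subset by blast
        then show False using interior_cells_disjoint[OF KL(1,2) xy(1)] xy(2) KL(3) interior_subset by blast
      qed
      show "isoparam ` interior K \<in> sets lebesgue" if "K \<in> cells M" for K
        using isoparam_cell_measurable(2)[OF that] by (simp add: borel_open)
      show "isoparam ` interior K \<subseteq> domain" if "K \<in> cells M" for K
        using isoparam_cell_measurable(3)[OF that] interior_subset by blast
    qed auto
    finally show ?thesis .
  qed
  have pointwise: "(w y)\<^sup>2 / 2 - 9 * \<theta>\<^sup>2 * N y \<le> (b y \<bullet> v y) * w y \<and>
      v y \<bullet> v y \<le> 2 * (w y)\<^sup>2 + 18 * \<theta>\<^sup>2 * N y" if y: "y \<in> domain" for y
  proof -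
    obtain x where x: "x \<in> polygon" "y = isoparam x" using y unfolding isoparam_image[symmetric] by (rule imageE)
    obtain K where K: "K \<in> cells M" "x \<in> K" using x(1) by (rule UnionE)
    define e where "e = v y - w y *\<^sub>R c K"
    have "norm e \<le> 3 * (m K * \<theta>)"
      unfolding e_def v_def x(2) 
    proof (rule interpolant_product_error[OF w K])
      show "norm (g (node M a) - c K) \<le> \<theta>" if "a \<in> ref_nodes p K" for a
        by (rule g[OF K(1) that])
      show "\<bar>w (isoparam x)\<bar> \<le> m K" if "x \<in> K" for x by (rule m(1)[OF K(1) that])
    qed
    then have "(norm e)\<^sup>2 \<le> (3 * (m K * \<theta>))\<^sup>2" by (intro power_mono) auto
    also have "\<dots> = 9 * \<theta>\<^sup>2 * (m K)\<^sup>2" by (simp add: power_mult_distrib)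
    also have "\<dots> \<le> 9 * \<theta>\<^sup>2 * N y"
    proof (rule mult_left_mono)
      have "(m K)\<^sup>2 * indicator (isoparam ` K) y \<le> N y"
        unfolding N_def using K(1) finite_cells
        by (intro member_le_sum[of K "cells M" "\<lambda>K. (m K)\<^sup>2 * indicator (isoparam ` K) y"]) auto
      then show "(m K)\<^sup>2 \<le> N y" using K(2) x(2) by simp
    qed simp
    finally have e: "(norm e)\<^sup>2 \<le> 9 * \<theta>\<^sup>2 * N y" .
    have v_eq: "v y = w y *\<^sub>R c K + e" by (simp add: e_def)
    have "\<bar>b y \<bullet> e\<bar> \<le> norm (b y) * norm e" by (rule Cauchy_Schwarz_ineq2)
    also have "\<dots> \<le> norm e" using b(2)[of y] by (simp add: mult_left_le_one_le)
    finally have be: "\<bar>b y \<bullet> e\<bar> \<le> norm e" .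
    \<comment> \<open>Young's inequality spends a quarter of \<open>w\<^sup>2\<close>, which leaves one half of the main term\<close>
    have "\<bar>(b y \<bullet> e) * w y\<bar> \<le> norm e * \<bar>w y\<bar>"
      using be by (simp add: abs_mult mult_right_mono)
    also have "\<dots> \<le> (norm e)\<^sup>2 + (w y)\<^sup>2 / 4"
      using zero_le_power2[of "norm e - \<bar>w y\<bar> / 2"] by (simp add: power2_diff power_divide)
    finally have cross: "- ((norm e)\<^sup>2 + (w y)\<^sup>2 / 4) \<le> (b y \<bullet> e) * w y" by linarith
    have "3 / 4 * (w y)\<^sup>2 \<le> (b y \<bullet> c K) * (w y)\<^sup>2"
      using c(2)[OF K] x(2) by (intro mult_right_mono) auto
    moreover have "(b y \<bullet> v y) * w y = (b y \<bullet> c K) * (w y)\<^sup>2 + (b y \<bullet> e) * w y"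
      by (simp add: v_eq inner_add_right power2_eq_square algebra_simps)
    ultimately have 1: "(w y)\<^sup>2 / 2 - 9 * \<theta>\<^sup>2 * N y \<le> (b y \<bullet> v y) * w y" using cross e by linarith
    have "norm (v y) \<le> \<bar>w y\<bar> + norm e"
      using norm_triangle_ineq[of "w y *\<^sub>R c K" e] c(1)[OF K(1)] by (simp add: v_eq)
    then have "(norm (v y))\<^sup>2 \<le> (\<bar>w y\<bar> + norm e)\<^sup>2" by (intro power_mono) auto
    also have "\<dots> \<le> 2 * (w y)\<^sup>2 + 2 * (norm e)\<^sup>2"
      using zero_le_power2[of "\<bar>w y\<bar> - norm e"] by (simp add: power2_diff power2_sum)
    finally have "v y \<bullet> v y \<le> 2 * (w y)\<^sup>2 + 18 * \<theta>\<^sup>2 * N y"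
      using e by (simp add: power2_norm_eq_inner)
    then show ?thesis using 1 by blast
  qed
  have small: "9 * \<theta>\<^sup>2 * (LINT y:domain|lebesgue. N y) \<le> W / 4"
  proof -
    have "0 \<le> W" using W by (metis zero_le_power2)
    have "9 * \<theta>\<^sup>2 * (LINT y:domain|lebesgue. N y) \<le> 9 * \<theta>\<^sup>2 * (C * W)"
      using N_le by (intro mult_left_mono) auto
    also have "\<dots> \<le> 1 / 4 * W" using mult_right_mono[OF \<theta>(2) \<open>0 \<le> W\<close>] by (simp add: mult.assoc)
    finally show ?thesis by simp
  qed
  have "W / 2 - 9 * \<theta>\<^sup>2 * (LINT y:domain|lebesgue. N y)
      = (LINT y:domain|lebesgue. (w y)\<^sup>2 / 2 - 9 * \<theta>\<^sup>2 * N y)"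
    using int_w int_N by (simp add: W_def set_integral_diff set_integrable_divide)
  also have "\<dots> \<le> (LINT y:domain|lebesgue. (b y \<bullet> v y) * w y)"
    using pointwise int_w int_N
    by (intro set_integral_mono set_integral_diff bform_integrable b vfe w set_integrable_mult_right
        set_integrable_divide) auto
  also have "\<dots> = bform p M b v w" by (simp add: bform_def l2_inner_def)
  finally show "(l2_norm domain w)\<^sup>2 / 4 \<le> bform p M b v w" using small W by linarith
  have "(l2_norm domain v)\<^sup>2 \<le> (LINT y:domain|lebesgue. 2 * (w y)\<^sup>2 + 18 * \<theta>\<^sup>2 * N y)"
    unfolding l2_norm_power2 using pointwise int_w int_N int_v
    by (intro set_integral_mono set_integral_add set_integrable_mult_right) auto
  also have "\<dots> = 2 * W + 18 * \<theta>\<^sup>2 * (LINT y:domain|lebesgue. N y)"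
    using int_w int_N by (simp add: W_def set_integral_add)
  also have "\<dots> \<le> (2 * l2_norm domain w)\<^sup>2"
  proof -
    have "(2 * l2_norm domain w)\<^sup>2 = 4 * W" by (simp add: power_mult_distrib W)
    moreover have "0 \<le> W" unfolding W[symmetric] by simp
    ultimately show ?thesis using small by linarith
  qed
  finally show "l2_norm domain v \<le> 2 * l2_norm domain w"
    by (rule power2_le_imp_le) (simp add: l2_norm_power2)
qed

lemma bform_zero_of_null:
  fixes b :: "real^2 \<Rightarrow> real^3"
  assumes v: "v \<in> vfe_space p M" and null: "l2_norm domain v = 0"
  shows "bform p M b v w = 0"
proof -
  have int: "integrable lebesgue (\<lambda>y. indicator domain y *\<^sub>R (v y \<bullet> v y))"
    using continuous_set_integrable[of "\<lambda>y. v y \<bullet> v y"] vfe_space_continuous[OF v]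
    by (simp add: set_integrable_def continuous_on_inner)
  have "(LINT y|lebesgue. indicator domain y *\<^sub>R (v y \<bullet> v y)) = 0"
    using l2_norm_power2(1)[of domain v] null by (simp add: set_lebesgue_integral_def)
  then have "AE y in lebesgue. indicator domain y *\<^sub>R (v y \<bullet> v y) = 0"
    using integral_nonneg_eq_0_iff_AE[OF int] by (auto simp: indicator_def)
  then have "AE y in lebesgue. indicator domain y *\<^sub>R ((b y \<bullet> v y) \<bullet> w y) = 0"
    by (rule eventually_mono) (auto simp: indicator_def split: if_splits)
  then show ?thesis
    unfolding bform_def l2_inner_def set_lebesgue_integral_def by (rule integral_eq_zero_AE)
qed

text \<open>If \<open>w\<close> is not null, coercivity forces the trial function to be nonzero, and not null either, so that
  the quotient is a genuine one. If \<open>w\<close> is null, a nonnegative quotient is needed: a supremum over the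
  empty set would be \<open>- \<infinity>\<close>. It comes from any nonzero \<open>v\<close> or from \<open>- v\<close>.\<close>

lemma sup_quotient_ge:
  fixes b :: "real^2 \<Rightarrow> real^3"
  assumes h: "mesh_size M < 1 / 2" and v: "v \<in> vfe_space0 p M"
    and coercive: "(l2_norm domain w)\<^sup>2 / 4 \<le> bform p M b v w"
    and bound: "l2_norm domain v \<le> 2 * l2_norm domain w"
  shows "ereal (1 / 8 * l2_norm domain w)
    \<le> (SUP v\<in>vfe_space0 p M - {\<lambda>x. 0}. ereal (bform p M b v w / l2_norm domain v))"
proof -
  have upper: "ereal q \<le> (SUP v\<in>vfe_space0 p M - {\<lambda>x. 0}. ereal (bform p M b v w / l2_norm domain v))"
    if "v \<in> vfe_space0 p M" "v \<noteq> (\<lambda>x. 0)" "q \<le> bform p M b v w / l2_norm domain v" for v q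
    using that by (intro SUP_upper2[of v]) auto
  show ?thesis
  proof (cases "l2_norm domain w = 0")
    case True
    obtain v where v: "v \<in> vfe_space0 p M" "v \<noteq> (\<lambda>x. 0)"
      using vfe_space0_nontrivial[OF h] by blast
    have neg: "bform p M b (\<lambda>x. - v x) w = - bform p M b v w"
      unfolding bform_def l2_inner_def set_lebesgue_integral_def by simp
    have "\<exists>v'\<in>vfe_space0 p M. v' \<noteq> (\<lambda>x. 0) \<and> 0 \<le> bform p M b v' w"
    proof (cases "0 \<le> bform p M b v w")
      case False
      moreover have "(\<lambda>x. - v x) \<noteq> (\<lambda>x. 0)" using v(2) by (auto simp: fun_eq_iff)
      ultimately show ?thesis using vfe_space0_uminus[OF v(1)] neg by force
    qed (use v in blast)
    then obtain v' where v': "v' \<in> vfe_space0 p M" "v' \<noteq> (\<lambda>x. 0)" "0 \<le> bform p M b v' w" by blast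
    have "0 \<le> bform p M b v' w / l2_norm domain v'" by (intro divide_nonneg_nonneg v'(3) l2_norm_power2(2))
    from upper[OF v'(1,2) this] show ?thesis using True by simp
  next
    case False
    then have w: "0 < l2_norm domain w" using l2_norm_power2(2)[of domain w] by simp
    have pos: "0 < bform p M b v w" using coercive w zero_less_power[OF w, of 2] by linarith
    have "l2_norm domain v \<noteq> 0"
      using bform_zero_of_null[of v b w] v vfe_space0_subset pos by force
    then have nv: "0 < l2_norm domain v" using l2_norm_power2(2)[of domain v] by simp
    have "v \<noteq> (\<lambda>x. 0)"
      using pos unfolding bform_def l2_inner_def set_lebesgue_integral_def by auto
    moreover have "1 / 8 * l2_norm domain w \<le> bform p M b v w / l2_norm domain v"
    proof -
      have "1 / 8 * l2_norm domain w * l2_norm domain v \<le> 1 / 8 * l2_norm domain w * (2 * l2_norm domain w)"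
        using bound w by (intro mult_left_mono) auto
      also have "\<dots> \<le> bform p M b v w" using coercive by (simp add: power2_eq_square)
      finally show ?thesis using nv by (simp add: field_simps)
    qed
    ultimately show ?thesis using upper v by blast
  qed
qed

lemma interpolant_product_vfe0:
  assumes w: "w \<in> fe_space0 p M"
  shows "interpolant (\<lambda>z. w z *\<^sub>R g z) \<in> vfe_space0 p M"
  by (rule interpolant_vfe0) (use w in \<open>auto simp: fe_space0_def\<close>)

end

section \<open>The normalized extrapolation of a uniformly accurate discrete solution\<close>

lemma norm_extrapolation_diff_le:
  fixes a b c :: "'a::real_normed_vector"
  assumes "norm (a - c) \<le> e" "norm (b - c) \<le> e"
  shows "norm (2 *\<^sub>R a - b - c) \<le> 3 * e"
proof -
  have "2 *\<^sub>R a - b - c = 2 *\<^sub>R (a - c) - (b - c)" by (simp add: algebra_simps scaleR_2)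
  also have "norm \<dots> \<le> norm (2 *\<^sub>R (a - c)) + norm (b - c)" by (rule norm_triangle_ineq4)
  finally show ?thesis using assms by simp
qed

lemma C_on_imp_continuous_on: "C_on m S f \<Longrightarrow> continuous_on S f"
  by (cases m) (auto simp: continuous_on_eq_continuous_within intro: has_derivative_continuous)

context disk_triangulation
begin

text \<open>Here \<open>d\<close> bounds the distance between any point of a triangle and the image of any other of its
  points, and \<open>\<epsilon>\<close> bounds both the discretization error and the oscillation of the exact solution over
  that distance and over one time step. On a small ball inside \<open>K\<close> an iterate is therefore within
  \<open>2 \<epsilon>\<close> of \<open>c\<close>; growth to \<open>K\<close> costs the factor \<open>64 B\<^sup>2\<close> and extrapolation the factor 3. The value of \<open>\<epsilon>\<close>
  is dictated by the absorption condition \<open>9 \<epsilon>\<^sup>2 C \<le> 1/4\<close> with \<open>C = (393216 B\<^sup>5)\<^sup>2\<close>, which is the stronger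
  one: the bound \<open>384 B\<^sup>2 \<epsilon> \<le> 1/7\<close> for the extrapolation follows. The tolerance \<open>r / (4608 B\<^sup>2)\<close> for the
  nodes becomes \<open>r / (1536 B\<^sup>2)\<close> for arbitrary points by the factor 3 of interpolation.\<close>

lemma infsup_of_close_solution:
  fixes uh U :: "nat \<Rightarrow> real^2 \<Rightarrow> real^3"
  assumes k: "k \<in> {1, 2}" and sol: "discrete_solution p k M \<tau> J u0 uh" and j: "j \<in> {k - 1..<J}"
    and h: "mesh_size M < 1 / 2" and B: "1 \<le> B"
    and elements: "\<And>K. K \<in> cells M \<Longrightarrow> \<exists>z r. 0 < r \<and> ball z r \<subseteq> K \<and> K \<subseteq> cball z (B * r) \<and>
      (\<forall>a\<in>ref_nodes p K. dist (node M a) a \<le> r / (4608 * B\<^sup>2))"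
    and U: "\<And>i. i \<le> J \<Longrightarrow> continuous_on (cball 0 1) (U i)"
      "\<And>i x. i \<le> J \<Longrightarrow> x \<in> ball 0 1 \<Longrightarrow> norm (U i x) = 1"
    and \<epsilon>: "\<epsilon> = 1 / (2359296 * B ^ 5)"
    and err: "\<And>i. i \<le> J \<Longrightarrow> linf_norm (ball 0 1 \<inter> domain) (\<lambda>x. uh i x - U i x) \<le> ereal \<epsilon>"
    and near: "\<And>K x z. K \<in> cells M \<Longrightarrow> x \<in> K \<Longrightarrow> z \<in> K \<Longrightarrow> dist (isoparam x) z \<le> d"
    and osc: "\<And>i y z. i \<in> {j - 1, j} \<Longrightarrow> y \<in> cball 0 1 \<Longrightarrow> z \<in> cball 0 1 \<Longrightarrow> dist y z \<le> d \<Longrightarrow>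
      norm (U i y - U j z) \<le> \<epsilon>"
    and w: "w \<in> fe_space0 p M"
  shows "ereal (1 / 8 * l2_norm domain w) \<le> (SUP v\<in>vfe_space0 p M - {\<lambda>x. 0}.
    ereal (bform p M (normalized_extrap k uh (j + 1)) v w / l2_norm domain v))"
proof -
  have \<epsilon>0: "0 \<le> \<epsilon>" using B \<epsilon> by simp
  have w': "w \<in> fe_space p M" using w unfolding fe_space0_def by simp
  \<comment> \<open>for \<open>k = 1\<close> and \<open>j = 0\<close> the index \<open>j - 1\<close> is \<open>j\<close> itself, so that it is an admissible time level\<close>
  have jJ: "i \<le> J" if "i \<in> {j - 1, j}" for i using that j by auto
  have "\<forall>K. \<exists>z r. K \<in> cells M \<longrightarrow> 0 < r \<and> ball z r \<subseteq> K \<and> K \<subseteq> cball z (B * r) \<and>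
      (\<forall>a\<in>ref_nodes p K. dist (node M a) a \<le> r / (4608 * B\<^sup>2))"
    using elements by blast
  then obtain z r where zr: "\<And>K. K \<in> cells M \<Longrightarrow> 0 < r K \<and> ball (z K) (r K) \<subseteq> K \<and>
      K \<subseteq> cball (z K) (B * r K) \<and> (\<forall>a\<in>ref_nodes p K. dist (node M a) a \<le> r K / (4608 * B\<^sup>2))"
    unfolding choice_iff by blast
  have r: "0 < r K" and ball: "ball (z K) (r K) \<subseteq> K" and cball: "K \<subseteq> cball (z K) (B * r K)"
    if "K \<in> cells M" for K using zr[OF that] by blast+
  have disp: "dist (isoparam x) x \<le> r K / (1536 * B\<^sup>2)" if "K \<in> cells M" "x \<in> K" for K x
    using isoparam_displacement[OF that, of "r K / (4608 * B\<^sup>2)"] zr[OF that(1)] by simp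
  have zK: "z K \<in> K" if "K \<in> cells M" for K using r[OF that] ball[OF that] by auto
  have inner: "ball (z K) (r K) \<subseteq> interior polygon" if "K \<in> cells M" for K
    using ball[OF that] that by (intro interior_maximal) auto
  have in_disk: "interior polygon \<subseteq> ball 0 1"
    using interior_mono[OF polygon_subset_disk] by simp
  define c where "c K = U j (z K)" for K
  have norm_c: "norm (c K) = 1" if "K \<in> cells M" for K
  proof -
    have "z K \<in> ball (z K) (r K)" using r[OF that] by simp
    then have "z K \<in> ball 0 1" using inner[OF that] in_disk by blast
    then show ?thesis unfolding c_def using U(2) jJ by simp
  qed
  have close: "norm (uh i (isoparam x) - c K) \<le> 64 * B\<^sup>2 * (2 * \<epsilon>)"
    if i: "i \<in> {j - 1, j}" and K: "K \<in> cells M" "x \<in> K" for i K x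
  proof (rule element_close_from_ball[OF _ K(1) ball[OF K(1)] cball[OF K(1)] r[OF K(1)] B _ K(2)])
    show vfe: "uh i \<in> vfe_space p M" using discrete_solution_vfe[OF k sol] jJ[OF i] by blast
    fix y assume y: "y \<in> cball (z K) (r K / 4)"
    have yK: "y \<in> K" "y \<in> interior polygon"
      using y r[OF K(1)] ball[OF K(1)] inner[OF K(1)] by (auto simp: subset_iff)
    have "r K / (1536 * B\<^sup>2) \<le> r K / 4"
      using r[OF K(1)] one_le_power[OF B, of 2] by (intro divide_left_mono) auto
    then have "dist (isoparam y) y \<le> r K / 4" using disp[OF K(1) yK(1)] by linarith
    then have "isoparam y \<in> ball (z K) (r K)"
      using y r[OF K(1)] dist_triangle[of "z K" "isoparam y" y] by (simp add: dist_commute)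
    then have isoparam_y: "isoparam y \<in> ball 0 1" using inner[OF K(1)] in_disk by blast
    moreover have "isoparam y \<in> interior domain" using yK(2) isoparam_interior by blast
    ultimately have "norm (uh i (isoparam y) - U i (isoparam y)) \<le> \<epsilon>"
      using linf_norm_pointwise[OF vfe U(1)[OF jJ[OF i]] err[OF jJ[OF i]]] by blast
    moreover have "norm (U i (isoparam y) - c K) \<le> \<epsilon>"
      unfolding c_def
    proof (rule osc[OF i])
      show "isoparam y \<in> cball 0 1" using isoparam_y by simp
      show "z K \<in> cball 0 1" using zK[OF K(1)] K(1) polygon_subset_disk by blast
      show "dist (isoparam y) (z K) \<le> d" by (rule near[OF K(1) yK(1) zK[OF K(1)]])
    qed
    ultimately show "norm (uh i (isoparam y) - c K) \<le> 2 * \<epsilon>"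
      using norm_triangle_ineq[of "uh i (isoparam y) - U i (isoparam y)" "U i (isoparam y) - c K"] by simp
  qed
  define Y where "Y x = (if k = 1 then uh j x else 2 *\<^sub>R uh j x - uh (j - 1) x)" for x
  have b_eq: "normalized_extrap k uh (j + 1) = (\<lambda>x. Y x /\<^sub>R norm (Y x))"
    unfolding normalized_extrap_def Let_def Y_def by (auto simp: fun_eq_iff)
  have Y_close: "norm (Y (isoparam x) - c K) \<le> 1 / 7" if K: "K \<in> cells M" "x \<in> K" for K x
  proof -
    have "norm (Y (isoparam x) - c K) \<le> 3 * (64 * B\<^sup>2 * (2 * \<epsilon>))"
    proof (cases "k = 1")
      case True
      have "0 \<le> 64 * B\<^sup>2 * (2 * \<epsilon>)" using \<epsilon>0 by simp
      moreover have "norm (Y (isoparam x) - c K) \<le> 64 * B\<^sup>2 * (2 * \<epsilon>)"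
        using True close[OF _ K, of j] by (simp add: Y_def)
      ultimately show ?thesis by linarith
    next
      case False
      then show ?thesis
        using norm_extrapolation_diff_le[OF close[OF _ K, of j] close[OF _ K, of "j - 1"]]
        by (simp add: Y_def)
    qed
    also have "\<dots> = 1 / (6144 * B ^ 3)" using B by (simp add: \<epsilon> field_simps eval_nat_numeral)
    also have "\<dots> \<le> 1 / 7"
    proof (rule divide_left_mono)
      show "7 \<le> 6144 * B ^ 3" using one_le_power[OF B, of 3] by linarith
    qed (use B in auto)
    finally show ?thesis .
  qed
  have "Y \<in> vfe_space p M"
  proof -
    have "uh j \<in> vfe_space p M" "uh (j - 1) \<in> vfe_space p M"
      using discrete_solution_vfe[OF k sol] jJ by auto
    then have "(\<lambda>x. 2 *\<^sub>R uh j x - uh (j - 1) x) \<in> vfe_space p M"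
      by (intro vfe_space_diff vfe_space_scaleR)
    then show ?thesis using \<open>uh j \<in> vfe_space p M\<close> unfolding Y_def by (cases "k = 1") auto
  qed
  then have Y_borel: "Y \<in> borel_measurable borel" by (rule vfe_borel)
  let ?C = "(393216 * B ^ 5)\<^sup>2"
  have "\<forall>K. \<exists>m. K \<in> cells M \<longrightarrow> (\<forall>x\<in>K. \<bar>w (isoparam x)\<bar> \<le> m) \<and>
      m\<^sup>2 * measure lebesgue (isoparam ` K) \<le> ?C * (LINT y:isoparam ` interior K|lebesgue. (w y)\<^sup>2)"
    using element_max_le_l2[OF w' _ ball cball r B disp] by blast
  then obtain m where m: "\<And>K. K \<in> cells M \<Longrightarrow> (\<forall>x\<in>K. \<bar>w (isoparam x)\<bar> \<le> m K) \<and>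
      (m K)\<^sup>2 * measure lebesgue (isoparam ` K) \<le> ?C * (LINT y:isoparam ` interior K|lebesgue. (w y)\<^sup>2)"
    unfolding choice_iff by blast
  let ?b = "\<lambda>x. Y x /\<^sub>R norm (Y x)" and ?v = "interpolant (\<lambda>z. w z *\<^sub>R U j z)"
  have b: "?b \<in> borel_measurable borel" "norm (?b y) \<le> 1" for y
    using Y_borel by (auto, cases "Y y = 0", auto)
  have ge: "3 / 4 \<le> ?b (isoparam x) \<bullet> c K" if "K \<in> cells M" "x \<in> K" for K x
    by (rule normalized_inner_ge[OF norm_c[OF that(1)] Y_close[OF that]])
  have nodes: "norm (U j (node M a) - c K) \<le> \<epsilon>" if K: "K \<in> cells M" "a \<in> ref_nodes p K" for K a
    unfolding c_def
  proof (rule osc)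
    show "node M a \<in> cball 0 1" by (rule node_in_disk[OF K])
    show "z K \<in> cball 0 1" using zK[OF K(1)] K(1) polygon_subset_disk by blast
    show "dist (node M a) (z K) \<le> d"
      using near[OF K(1) ref_nodes_in_cell[OF K] zK[OF K(1)]] isoparam_node[OF K] by simp
  qed simp
  have "9 * \<epsilon>\<^sup>2 * ?C = (3 * \<epsilon> * (393216 * B ^ 5))\<^sup>2" by (simp add: power_mult_distrib)
  also have "3 * \<epsilon> * (393216 * B ^ 5) = 1 / 2" using B by (simp add: \<epsilon>)
  finally have \<epsilon>C: "9 * \<epsilon>\<^sup>2 * ?C \<le> 1 / 4" by (simp add: power_divide)
  have max: "\<bar>w (isoparam x)\<bar> \<le> m K" if "K \<in> cells M" "x \<in> K" for K x
    using m[OF that(1)] that(2) by blast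
  have max_l2: "(m K)\<^sup>2 * measure lebesgue (isoparam ` K) \<le> ?C * (LINT y:isoparam ` interior K|lebesgue. (w y)\<^sup>2)"
    if "K \<in> cells M" for K
    using m[OF that] by blast
  have "(l2_norm domain w)\<^sup>2 / 4 \<le> bform p M ?b ?v w" "l2_norm domain ?v \<le> 2 * l2_norm domain w"
    by (rule interpolant_product_coercive[where c = c and m = m and \<theta> = \<epsilon> and C = ?C];
        fact w' b norm_c ge nodes max max_l2 \<epsilon>0 \<epsilon>C zero_le_power2)+
  then show ?thesis
    unfolding b_eq by (rule sup_quotient_ge[OF h interpolant_product_vfe0[OF w]])
qed

end

text \<open>The radius \<open>r = diameter K / B\<close> stays comparable to the mesh size by quasi-uniformity, whereas nodes
  move by \<open>O(h\<^sup>2)\<close> only. The maximum in \<open>B\<close> keeps \<open>B \<ge> 1\<close>, so that \<open>B r\<close> is at least \<open>r\<close>.\<close>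

lemma (in disk_triangulation) elements_of_regular_mesh:
  assumes K: "K \<in> cells M" and \<sigma>: "0 < \<sigma>" "\<exists>z. ball z (\<sigma> * diameter K) \<subseteq> K"
    and \<kappa>: "0 < \<kappa>" "\<kappa> * mesh_size M \<le> diameter K"
    and D: "0 \<le> D" "\<And>a. a \<in> ref_nodes p K \<Longrightarrow> dist (node M a) a \<le> D * (mesh_size M)\<^sup>2"
    and B: "B = max 1 (1 / \<sigma>)" and h: "mesh_size M * (4608 * B ^ 3 * D) \<le> \<kappa>"
  shows "\<exists>z r. 0 < r \<and> ball z r \<subseteq> K \<and> K \<subseteq> cball z (B * r) \<and>
    (\<forall>a\<in>ref_nodes p K. dist (node M a) a \<le> r / (4608 * B\<^sup>2))"
proof -
  have B1: "1 \<le> B" "1 / \<sigma> \<le> B" using B by auto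
  have bounded: "bounded K" using cell_compact[OF K] compact_imp_bounded by blast
  have diam: "0 < diameter K"
  proof -
    have "card (vertices K) = 3" using cell_triangle(1)[OF K] unfolding triangle_corners_def by blast
    then obtain a b where ab: "a \<in> vertices K" "b \<in> vertices K" "a \<noteq> b"
      unfolding card_3_iff by blast
    then have "dist a b \<le> diameter K"
      using diameter_bounded_bound[OF bounded] unfolding vertices_def extreme_point_of_def by blast
    then show ?thesis using ab(3) by (metis dist_pos_lt less_le_trans)
  qed
  define r where "r = diameter K / B"
  have r: "0 < r" "B * r = diameter K" using diam B1 by (simp_all add: r_def)
  obtain z where z: "ball z (\<sigma> * diameter K) \<subseteq> K" using \<sigma>(2) by blast
  have "r \<le> \<sigma> * diameter K"
  proof -
    have "1 \<le> \<sigma> * B" using B1(2) \<sigma>(1) by (simp add: field_simps)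
    then have "1 * diameter K \<le> \<sigma> * B * diameter K" using diam by (intro mult_right_mono) auto
    then show ?thesis using B1 by (simp add: r_def field_simps)
  qed
  then have ball: "ball z r \<subseteq> K" using z subset_ball by blast
  have "z \<in> K" using ball r(1) by auto
  then have "K \<subseteq> cball z (B * r)"
    using diameter_bounded_bound[OF bounded] r(2) by auto
  moreover have "dist (node M a) a \<le> r / (4608 * B\<^sup>2)" if "a \<in> ref_nodes p K" for a
  proof -
    have h0: "0 \<le> mesh_size M" using diam diameter_le_mesh_size[OF K] by linarith
    have "mesh_size M * (4608 * B ^ 3 * D) * mesh_size M \<le> \<kappa> * mesh_size M"
      using h h0 by (rule mult_right_mono)
    also have "\<dots> \<le> B * r" using \<kappa>(2) r(2) by simp
    finally have "(D * (mesh_size M)\<^sup>2 * (4608 * B\<^sup>2)) * B \<le> r * B"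
      by (simp add: power2_eq_square power3_eq_cube mult_ac)
    then have "D * (mesh_size M)\<^sup>2 * (4608 * B\<^sup>2) \<le> r" using B1 by simp
    then have "D * (mesh_size M)\<^sup>2 \<le> r / (4608 * B\<^sup>2)" using B1 by (simp add: pos_le_divide_eq)
    then show ?thesis using D(2)[OF that] by linarith
  qed
  ultimately show ?thesis using r(1) ball by blast
qed

theorem lemma3p1:
  fixes p k :: nat and T :: real
    and u0 :: "real^2 \<Rightarrow> real^3" and u :: "real \<Rightarrow> real^2 \<Rightarrow> real^3"
  assumes "p \<in> {1, 2}" and "k \<in> {1, 2}" and "T > 0"
    and "C_on 2 (cball 0 1) u0" and "u0 ` cball 0 1 \<subseteq> sphere 0 1"
    and "hmhf_solution T u0 u"
    and "C_on 2 ({0..T} \<times> cball 0 1) (\<lambda>(t, x). u t x)"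
  shows "\<exists>\<beta>>0. \<forall>\<M>. regular_family p \<M> \<longrightarrow> uniformly_convergent p k \<M> T u0 u \<longrightarrow>
    (\<exists>\<tau>0>0. \<exists>h0>0. \<forall>M\<in>\<M>. \<forall>\<tau>>0. \<forall>J uh.
       real J * \<tau> = T \<longrightarrow> \<tau> \<le> \<tau>0 \<longrightarrow> mesh_size M \<le> h0 \<longrightarrow> discrete_solution p k M \<tau> J u0 uh \<longrightarrow>
       (\<forall>w\<in>fe_space0 p M. \<forall>j\<in>{k - 1..<J}.
          (SUP v\<in>vfe_space0 p M - {\<lambda>x. 0}.
             ereal (bform p M (normalized_extrap k uh (j + 1)) v w / l2_norm (mesh_domain p M) v))
          \<ge> ereal (\<beta> * l2_norm (mesh_domain p M) w)))"
proof (rule exI[of _ "1 / 8"], intro conjI allI impI)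
  fix \<M> assume regular: "regular_family p \<M>" and conv: "uniformly_convergent p k \<M> T u0 u"
  have "continuous_on ({0..T} \<times> cball 0 1) (\<lambda>(t, x). u t x)"
    using assms(7) by (rule C_on_imp_continuous_on)
  then have unif: "uniformly_continuous_on ({0..T} \<times> cball 0 1) (\<lambda>(t, x). u t x)"
    by (intro compact_uniformly_continuous compact_Times) auto
  have meshes: "\<forall>M\<in>\<M>. disk_mesh p M"
    and shape: "\<exists>\<sigma>>0. \<forall>M\<in>\<M>. \<forall>K\<in>cells M. \<exists>z. ball z (\<sigma> * diameter K) \<subseteq> K"
    and uniform: "\<exists>\<kappa>>0. \<forall>M\<in>\<M>. \<forall>K\<in>cells M. \<kappa> * mesh_size M \<le> diameter K"
    and moved: "\<exists>D. \<forall>M\<in>\<M>. \<forall>K\<in>cells M. \<forall>a\<in>ref_nodes p K. dist (node M a) a \<le> D * (mesh_size M)\<^sup>2"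
    using regular[unfolded regular_family_def] by - (elim conjE, assumption)+
  obtain \<sigma> where \<sigma>: "0 < \<sigma>" "\<And>M K. M \<in> \<M> \<Longrightarrow> K \<in> cells M \<Longrightarrow> \<exists>z. ball z (\<sigma> * diameter K) \<subseteq> K"
    using shape by blast
  obtain \<kappa> where \<kappa>: "0 < \<kappa>" "\<And>M K. M \<in> \<M> \<Longrightarrow> K \<in> cells M \<Longrightarrow> \<kappa> * mesh_size M \<le> diameter K"
    using uniform by blast
  obtain D' where D': "\<And>M K a. M \<in> \<M> \<Longrightarrow> K \<in> cells M \<Longrightarrow> a \<in> ref_nodes p K \<Longrightarrow>
      dist (node M a) a \<le> D' * (mesh_size M)\<^sup>2"
    using moved by blast
  define D where "D = max D' 0"
  have D: "0 \<le> D" "dist (node M a) a \<le> D * (mesh_size M)\<^sup>2"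
    if "M \<in> \<M>" "K \<in> cells M" "a \<in> ref_nodes p K" for M K a
  proof -
    have "D' * (mesh_size M)\<^sup>2 \<le> D * (mesh_size M)\<^sup>2" by (intro mult_right_mono) (auto simp: D_def)
    then show "dist (node M a) a \<le> D * (mesh_size M)\<^sup>2" using D'[OF that] by linarith
  qed (simp add: D_def)
  have D0: "0 \<le> D" by (simp add: D_def)
  define B where "B = max 1 (1 / \<sigma>)"
  have B: "1 \<le> B" by (simp add: B_def)
  define \<epsilon> where "\<epsilon> = 1 / (2359296 * B ^ 5)"
  have "0 < \<epsilon>" using B by (simp add: \<epsilon>_def)
  have "\<epsilon> \<le> 1 / 1"
    unfolding \<epsilon>_def
  proof (rule divide_left_mono)
    show "1 \<le> 2359296 * B ^ 5" using one_le_power[OF B, of 5] by linarith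
  qed (use B in auto)
  then have "\<epsilon> \<in> {0<..1}" using \<open>0 < \<epsilon>\<close> by simp
  then obtain \<epsilon>1 \<epsilon>2 where \<epsilon>12: "0 < \<epsilon>1" "0 < \<epsilon>2" and err: "\<And>M \<tau> J uh. M \<in> \<M> \<Longrightarrow> 0 < \<tau> \<Longrightarrow>
      real J * \<tau> = T \<Longrightarrow> \<tau> \<le> \<epsilon>1 \<Longrightarrow> mesh_size M \<le> \<epsilon>2 \<Longrightarrow> discrete_solution p k M \<tau> J u0 uh \<Longrightarrow>
      max_error p M \<tau> J u uh \<le> ereal \<epsilon>"
    using conv unfolding uniformly_convergent_def by meson
  obtain \<eta> where \<eta>: "0 < \<eta>" "\<And>s t x y. s \<in> {0..T} \<Longrightarrow> t \<in> {0..T} \<Longrightarrow> x \<in> cball 0 1 \<Longrightarrow> y \<in> cball 0 1 \<Longrightarrow>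
      dist (s, x) (t, y) < \<eta> \<Longrightarrow> dist (u s x) (u t y) < \<epsilon>"
    using unif \<open>0 < \<epsilon>\<close> unfolding uniformly_continuous_on_def by fastforce
  \<comment> \<open>the time step uses up one half of the modulus of continuity \<open>\<eta>\<close>, and the distance
    \<open>3 D h\<^sup>2 + h \<le> (3 D + 1) h\<close> in space one quarter; the denominator with \<open>D + 1\<close> avoids a
    division by 0 for \<open>D = 0\<close>\<close>
  define \<tau>0 where "\<tau>0 = min \<epsilon>1 (\<eta> / 2)"
  define h0 where "h0 = min (min \<epsilon>2 (1 / 4)) (min (\<kappa> / (4608 * B ^ 3 * (D + 1))) (\<eta> / (4 * (3 * D + 1))))"
  have "0 < \<tau>0" using \<epsilon>12 \<eta>(1) by (simp add: \<tau>0_def)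
  have "0 < h0" using \<epsilon>12 \<kappa>(1) \<eta>(1) B D0 by (simp add: h0_def)
  show "\<exists>\<tau>0>0. \<exists>h0>0. \<forall>M\<in>\<M>. \<forall>\<tau>>0. \<forall>J uh.
       real J * \<tau> = T \<longrightarrow> \<tau> \<le> \<tau>0 \<longrightarrow> mesh_size M \<le> h0 \<longrightarrow> discrete_solution p k M \<tau> J u0 uh \<longrightarrow>
       (\<forall>w\<in>fe_space0 p M. \<forall>j\<in>{k - 1..<J}.
          (SUP v\<in>vfe_space0 p M - {\<lambda>x. 0}.
             ereal (bform p M (normalized_extrap k uh (j + 1)) v w / l2_norm (mesh_domain p M) v))
          \<ge> ereal (1 / 8 * l2_norm (mesh_domain p M) w))"
  proof (rule exI[of _ \<tau>0], rule conjI[OF \<open>0 < \<tau>0\<close>], rule exI[of _ h0],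
      rule conjI[OF \<open>0 < h0\<close>], intro ballI allI impI)
    fix M \<tau> J uh w j
    assume M: "M \<in> \<M>" and \<tau>: "0 < \<tau>" "real J * \<tau> = T" "\<tau> \<le> \<tau>0" and h: "mesh_size M \<le> h0"
      and sol: "discrete_solution p k M \<tau> J u0 uh" and w: "w \<in> fe_space0 p M" and j: "j \<in> {k - 1..<J}"
    interpret disk_triangulation p M
      using assms(1) meshes M by unfold_locales auto
    have hs: "mesh_size M \<le> \<epsilon>2" "mesh_size M < 1 / 2"
      "mesh_size M \<le> \<kappa> / (4608 * B ^ 3 * (D + 1))" "mesh_size M \<le> \<eta> / (4 * (3 * D + 1))"
      using h by (auto simp: h0_def)
    have time: "real i * \<tau> \<in> {0..T}" if "i \<le> J" for i
      using that \<tau> mult_right_mono[of "real i" "real J" \<tau>] by auto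
    show "ereal (1 / 8 * l2_norm domain w) \<le> (SUP v\<in>vfe_space0 p M - {\<lambda>x. 0}.
        ereal (bform p M (normalized_extrap k uh (j + 1)) v w / l2_norm domain v))"
    proof (rule infsup_of_close_solution[OF assms(2) sol j hs(2) B, where \<epsilon> = \<epsilon>
          and U = "\<lambda>i. u (real i * \<tau>)" and d = "(3 * D + 1) * mesh_size M"])
      fix K assume K: "K \<in> cells M"
      show "\<exists>z r. 0 < r \<and> ball z r \<subseteq> K \<and> K \<subseteq> cball z (B * r) \<and>
          (\<forall>a\<in>ref_nodes p K. dist (node M a) a \<le> r / (4608 * B\<^sup>2))"
      proof (rule elements_of_regular_mesh[OF K \<sigma>(1) \<sigma>(2)[OF M K] \<kappa>(1) \<kappa>(2)[OF M K] D0 D(2)[OF M K] B_def])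
        have B3: "0 < 4608 * B ^ 3 * (D + 1)" using B D0 by simp
        have "0 \<le> mesh_size M"
          using diameter_le_mesh_size[OF K] diameter_ge_0[OF compact_imp_bounded[OF cell_compact[OF K]]]
          by linarith
        then have "mesh_size M * (4608 * B ^ 3 * D) \<le> mesh_size M * (4608 * B ^ 3 * (D + 1))"
          using B by (intro mult_left_mono) auto
        also have "\<dots> \<le> \<kappa>" using hs(3) B3 by (simp add: pos_le_divide_eq)
        finally show "mesh_size M * (4608 * B ^ 3 * D) \<le> \<kappa>" .
      qed
    next
      fix i assume i: "i \<le> J"
      have "continuous_on (cball 0 1) (\<lambda>x. case (real i * \<tau>, x) of (t, x) \<Rightarrow> u t x)"
        by (rule continuous_on_compose2[OF \<open>continuous_on ({0..T} \<times> cball 0 1) (\<lambda>(t, x). u t x)\<close>])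
          (use time[OF i] in \<open>auto intro!: continuous_intros\<close>)
      then show "continuous_on (cball 0 1) (u (real i * \<tau>))" by simp
      show "norm (u (real i * \<tau>) x) = 1" if "x \<in> ball 0 1" for x
        using assms(6) time[OF i] that unfolding hmhf_solution_def by simp
      have "linf_norm (ball 0 1 \<inter> domain) (\<lambda>x. uh i x - u (real i * \<tau>) x) \<le> max_error p M \<tau> J u uh"
        unfolding max_error_def using i by (intro Max_ge) auto
      also have "\<dots> \<le> ereal \<epsilon>" using err[OF M \<tau>(1,2) _ hs(1) sol] \<tau>(3) by (simp add: \<tau>0_def)
      finally show "linf_norm (ball 0 1 \<inter> domain) (\<lambda>x. uh i x - u (real i * \<tau>) x) \<le> ereal \<epsilon>" .
    next
      fix K x z assume K: "K \<in> cells M" "x \<in> K" "z \<in> K"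
      have "dist (isoparam x) x \<le> 3 * (D * (mesh_size M)\<^sup>2)"
        by (rule isoparam_displacement[OF K(1,2) D(2)[OF M K(1)]])
      also have "\<dots> \<le> 3 * D * mesh_size M"
      proof -
        have "0 \<le> mesh_size M"
          using diameter_le_mesh_size[OF K(1)] diameter_ge_0[OF compact_imp_bounded[OF cell_compact[OF K(1)]]]
          by linarith
        then have "(mesh_size M)\<^sup>2 \<le> mesh_size M" using hs(2) by (simp add: power2_eq_square mult_left_le)
        then show ?thesis using D0 by (simp add: mult_left_mono)
      qed
      finally have "dist (isoparam x) x \<le> 3 * D * mesh_size M" .
      moreover have "dist x z \<le> mesh_size M"
        using diameter_bounded_bound[OF compact_imp_bounded[OF cell_compact[OF K(1)]] K(2,3)]
          diameter_le_mesh_size[OF K(1)] by linarith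
      ultimately show "dist (isoparam x) z \<le> (3 * D + 1) * mesh_size M"
        using dist_triangle[of "isoparam x" z x] by (simp add: algebra_simps)
    next
      fix i y z assume i: "i \<in> {j - 1, j}" and yz: "y \<in> cball (0::real^2) 1" "z \<in> cball (0::real^2) 1"
        "dist y z \<le> (3 * D + 1) * mesh_size M"
      have "i \<le> J" "j \<le> J" using i j by auto
      have "dist (real i * \<tau>) (real j * \<tau>) \<le> \<tau>"
      proof -
        have "dist (real i * \<tau>) (real j * \<tau>) = \<bar>real i - real j\<bar> * \<tau>"
          using \<tau>(1) by (simp add: dist_real_def abs_mult left_diff_distrib[symmetric])
        also have "\<dots> \<le> 1 * \<tau>" using i \<tau>(1) by (intro mult_right_mono) auto
        finally show ?thesis by simp
      qed
      also have "\<tau> \<le> \<eta> / 2" using \<tau>(3) by (simp add: \<tau>0_def)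
      finally have "dist (real i * \<tau>) (real j * \<tau>) \<le> \<eta> / 2" .
      moreover have "dist y z \<le> \<eta> / 4"
      proof -
        have "(3 * D + 1) * mesh_size M \<le> (3 * D + 1) * (\<eta> / (4 * (3 * D + 1)))"
          using hs(4) D0 by (intro mult_left_mono) auto
        also have "\<dots> = \<eta> / 4" using D0 by (simp add: field_simps add_nonneg_eq_0_iff)
        finally show ?thesis using yz(3) by linarith
      qed
      moreover have "dist (real i * \<tau>, y) (real j * \<tau>, z) \<le> dist (real i * \<tau>) (real j * \<tau>) + dist y z"
        unfolding dist_Pair_Pair by (rule sqrt_sum_squares_le_sum) auto
      ultimately have "dist (real i * \<tau>, y) (real j * \<tau>, z) < \<eta>" using \<eta>(1) by linarith
      then have "dist (u (real i * \<tau>) y) (u (real j * \<tau>) z) < \<epsilon>"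
        using \<eta>(2) time[OF \<open>i \<le> J\<close>] time[OF \<open>j \<le> J\<close>] yz by blast
      then show "norm (u (real i * \<tau>) y - u (real j * \<tau>) z) \<le> \<epsilon>" by (simp add: dist_norm)
    qed (use w in \<open>auto simp: \<epsilon>_def\<close>)
  qed
qed simp

end
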